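(* Let $\{W_t\}_{t\ge0}$ be a one-dimensional Brownian motion and let $0\le a<b<\infty$. For any $\Phi\in C^1(\mathbb{R},\mathbb{R})$, the limit in probability $$\int_a^b\Phi(W_t)\star\mathrm{d}W_t:=\lim_{\|\Delta_n\|\to0}\sum_{j=1}^n\Phi(W_{t_j^*})(W_{t_j}-W_{t_{j-1}})$$ exists, and the equality $$\int_a^b\Phi(W_t)\star\mathrm{d}W_t=\int_a^b\Phi(W_t)\,\mathrm{d}W_t+\frac{255}{512}\int_a^b\Phi'(W_t)\,\mathrm{d}t$$ holds almost surely, where the first integral on the right-hand side is an It\^o integral.
   Context: Here $\Delta_n=\{t_0,t_1,\dots,t_n\}$ is a partition of $[a,b]$, $\|\Delta_n\|=\max_{1\le j\le n}(t_j-t_{j-1})$ is its diameter, and $t_j^*=\lambda t_j+(1-\lambda)t_{j-1}$ with $\lambda=255/512$. The limit is called the Fehlberg $255/512$-integral of $\Phi(W_t)$ on $[a,b]$ with respect to $W$. *)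

theory Defs
  imports "HOL-Probability.Probability"
begin

locale brownian_motion = prob_space M
  for M :: "'a measure" and W :: "real \<Rightarrow> 'a \<Rightarrow> real" +
  assumes random_variable_W: "\<And>t. 0 \<le> t \<Longrightarrow> W t \<in> borel_measurable M"
    and start_zero: "AE \<omega> in M. W 0 \<omega> = 0"
    and indep_increments:
      "\<And>n t. 0 \<le> t 0 \<Longrightarrow> (\<forall>j<n. t j < t (Suc j)) \<Longrightarrow>
         indep_vars (\<lambda>_. borel) (\<lambda>j \<omega>. W (t (Suc j)) \<omega> - W (t j) \<omega>) {..<n :: nat}"
    and normal_increments:
      "\<And>s t. 0 \<le> s \<Longrightarrow> s < t \<Longrightarrow>
         distributed M lborel (\<lambda>\<omega>. W t \<omega> - W s \<omega>) (normal_density 0 (sqrt (t - s)))"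
    and continuous_paths: "AE \<omega> in M. continuous_on {0..} (\<lambda>t. W t \<omega>)"

definition natural_filtration ::
    "'a measure \<Rightarrow> (real \<Rightarrow> 'a \<Rightarrow> real) \<Rightarrow> real \<Rightarrow> 'a measure" where
  "natural_filtration M W t =
     sigma (space M) {W s -` A \<inter> space M | s A. 0 \<le> s \<and> s \<le> t \<and> A \<in> sets borel}"

text \<open>Convergence in probability along an arbitrary filter. Measurability is part of the
  definition because \<open>measure M\<close> is 0 on non-measurable sets.\<close>

definition tendsto_in_prob ::
    "'a measure \<Rightarrow> ('i \<Rightarrow> 'a \<Rightarrow> real) \<Rightarrow> ('a \<Rightarrow> real) \<Rightarrow> 'i filter \<Rightarrow> bool" where
  "tendsto_in_prob M Y L F \<longleftrightarrow>
     (\<forall>\<^sub>F i in F. Y i \<in> borel_measurable M) \<and> L \<in> borel_measurable M \<and>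
     (\<forall>\<epsilon>>0. ((\<lambda>i. measure M {\<omega> \<in> space M. \<bar>Y i \<omega> - L \<omega>\<bar> > \<epsilon>}) \<longlongrightarrow> 0) F)"

text \<open>A partition \<open>a = t 0 < t 1 < \<dots> < t n = b\<close> is coded as the pair \<open>(n, t)\<close>; the values
  of \<open>t\<close> beyond \<open>n\<close> are irrelevant.\<close>

type_synonym partition = "nat \<times> (nat \<Rightarrow> real)"

definition partitions :: "real \<Rightarrow> real \<Rightarrow> partition set" where
  "partitions a b = {(n, t). t 0 = a \<and> t n = b \<and> (\<forall>j<n. t j < t (Suc j))}"

definition mesh :: "partition \<Rightarrow> real" where
  "mesh = (\<lambda>(n, t). Max ((\<lambda>j. t j - t (j - 1)) ` {1..n}))"

definition mesh_to_0 :: "real \<Rightarrow> real \<Rightarrow> partition filter" where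
  "mesh_to_0 a b = (INF \<delta>\<in>{0<..}. principal {\<Delta> \<in> partitions a b. mesh \<Delta> < \<delta>})"

definition lambda_sum ::
    "real \<Rightarrow> (real \<Rightarrow> 'a \<Rightarrow> real) \<Rightarrow> (real \<Rightarrow> 'a \<Rightarrow> real) \<Rightarrow> partition \<Rightarrow> 'a \<Rightarrow> real" where
  "lambda_sum l W X = (\<lambda>(n, t) \<omega>.
     \<Sum>j=1..n. X (l * t j + (1 - l) * t (j - 1)) \<omega> * (W (t j) \<omega> - W (t (j - 1)) \<omega>))"

definition has_fehlberg_integral ::
    "'a measure \<Rightarrow> (real \<Rightarrow> 'a \<Rightarrow> real) \<Rightarrow> real \<Rightarrow> real \<Rightarrow> (real \<Rightarrow> 'a \<Rightarrow> real) \<Rightarrow> ('a \<Rightarrow> real) \<Rightarrow> bool" where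
  "has_fehlberg_integral M W a b X L \<longleftrightarrow>
     tendsto_in_prob M (lambda_sum (255 / 512) W X) L (mesh_to_0 a b)"

text \<open>Limits in probability are unique only up to null sets; this picks a version.\<close>

definition fehlberg_integral ::
    "'a measure \<Rightarrow> (real \<Rightarrow> 'a \<Rightarrow> real) \<Rightarrow> real \<Rightarrow> real \<Rightarrow> (real \<Rightarrow> 'a \<Rightarrow> real) \<Rightarrow> 'a \<Rightarrow> real" where
  "fehlberg_integral M W a b X = (SOME L. has_fehlberg_integral M W a b X L)"

text \<open>The triple \<open>(n, s, \<xi>)\<close> codes the simple process that equals \<open>\<xi> j\<close> on the interval from
  \<open>s j\<close> to \<open>s (Suc j)\<close>, where \<open>\<xi> j\<close> is bounded and known at time \<open>s j\<close>.\<close>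

type_synonym 'a simple_process = "nat \<times> (nat \<Rightarrow> real) \<times> (nat \<Rightarrow> 'a \<Rightarrow> real)"

definition simple_processes ::
    "'a measure \<Rightarrow> (real \<Rightarrow> 'a measure) \<Rightarrow> real \<Rightarrow> real \<Rightarrow> 'a simple_process set" where
  "simple_processes M \<F> a b = {(n, s, \<xi>). (n, s) \<in> partitions a b \<and>
     (\<forall>j<n. \<xi> j \<in> borel_measurable (\<F> (s j)) \<and> (\<exists>C. \<forall>\<omega>\<in>space M. \<bar>\<xi> j \<omega>\<bar> \<le> C))}"

definition simple_eval :: "'a simple_process \<Rightarrow> real \<Rightarrow> 'a \<Rightarrow> real" where
  "simple_eval = (\<lambda>(n, s, \<xi>) t \<omega>. \<Sum>j<n. \<xi> j \<omega> * indicator {s j<..s (Suc j)} t)"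

definition simple_integral_wrt :: "(real \<Rightarrow> 'a \<Rightarrow> real) \<Rightarrow> 'a simple_process \<Rightarrow> 'a \<Rightarrow> real" where
  "simple_integral_wrt W = (\<lambda>(n, s, \<xi>) \<omega>. \<Sum>j<n. \<xi> j \<omega> * (W (s (Suc j)) \<omega> - W (s j) \<omega>))"

text \<open>The Ito integral, extended from square-integrable integrands to adapted \<open>X\<close> whose paths
  are almost surely in \<open>L\<^sup>2[a,b]\<close>: the limit in probability of the integrals of simple processes
  whose \<open>L\<^sup>2[a,b]\<close> distance to \<open>X\<close> tends to 0 in probability. That distance is only
  required to be measurable for the completion of \<open>M\<close>, since paths of \<open>X\<close> may be
  irregular on a null set and \<open>M\<close> need not be complete.\<close>

definition has_ito_integral ::
    "'a measure \<Rightarrow> (real \<Rightarrow> 'a \<Rightarrow> real) \<Rightarrow> real \<Rightarrow> real \<Rightarrow> (real \<Rightarrow> 'a \<Rightarrow> real) \<Rightarrow> ('a \<Rightarrow> real) \<Rightarrow> bool" where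
  "has_ito_integral M W a b X I \<longleftrightarrow>
     (\<forall>t\<in>{a..b}. X t \<in> borel_measurable (natural_filtration M W t)) \<and>
     (AE \<omega> in M. set_borel_measurable lborel {a..b} (\<lambda>t. X t \<omega>) \<and>
                 set_integrable lborel {a..b} (\<lambda>t. (X t \<omega>)\<^sup>2)) \<and>
     (\<exists>f. (\<forall>k. f k \<in> simple_processes M (natural_filtration M W) a b) \<and>
          tendsto_in_prob (completion M)
            (\<lambda>k \<omega>. LBINT t:{a..b}. (simple_eval (f k) t \<omega> - X t \<omega>)\<^sup>2) (\<lambda>_. 0) sequentially \<and>
          tendsto_in_prob M (\<lambda>k. simple_integral_wrt W (f k)) I sequentially)"

text \<open>As before, a version: the integral is determined up to null sets.\<close>

definition ito_integral ::
    "'a measure \<Rightarrow> (real \<Rightarrow> 'a \<Rightarrow> real) \<Rightarrow> real \<Rightarrow> real \<Rightarrow> (real \<Rightarrow> 'a \<Rightarrow> real) \<Rightarrow> 'a \<Rightarrow> real" where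
  "ito_integral M W a b X = (SOME I. has_ito_integral M W a b X I)"

end

theory Submission
  imports Defs
begin

text \<open>Fix \<open>\<lambda>\<close> between 0 and 1 and write \<open>u < w < v\<close> for two neighbouring partition points \<open>u, v\<close> and the
  evaluation point \<open>w = \<lambda> v + (1 - \<lambda>) u\<close>. Splitting \<open>W v - W u\<close> at \<open>w\<close> and expanding \<open>\<Phi>\<close> to first
  order at \<open>W u\<close> writes each summand \<open>\<Phi> (W w) (W v - W u)\<close> as a sum of five terms (\<open>lambda_sum_eq\<close>):

  \<^item> the left-point term \<open>\<Phi> (W u) (W v - W u)\<close>, which leads to the Ito integral;
  \<^item> \<open>(\<Phi> (W w) - \<Phi> (W u)) (W v - W w)\<close>, a small factor known at time \<open>w\<close> times a future increment;
  \<^item> \<open>\<Phi>' (W u) ((W w - W u)\<^sup>2 - (w - u))\<close>, a factor known at time \<open>u\<close> times a centred future variable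
    of variance \<open>2 (w - u)\<^sup>2\<close>;
  \<^item> the first-order remainder of \<open>\<Phi>\<close> times \<open>W w - W u\<close>, which on each
    continuous path is at most \<open>\<theta> (W w - W u)\<^sup>2\<close> once the mesh is fine enough;
  \<^item> \<open>\<Phi>' (W u) (w - u) = \<lambda> \<Phi>' (W u) (v - u)\<close>, a Riemann sum for \<open>\<lambda> \<integral> \<Phi>' (W t) dt\<close>.

  The second and third sums vanish in the limit by one inequality for sums \<open>\<Sum> \<xi>\<^sub>j d\<^sub>j\<close>, in which \<open>\<xi>\<^sub>j\<close> is
  known before the centred variable \<open>d\<^sub>j\<close> of variance \<open>v\<^sub>j\<close> is drawn: such a sum exceeds \<open>\<epsilon>\<close> with
  probability at most \<open>P(\<Sum> \<xi>\<^sub>j\<^sup>2 v\<^sub>j > \<delta>) + \<delta> / \<epsilon>\<^sup>2\<close> (\<open>martingale_transform_tail_bound\<close>). The right-hand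
  side is a probability instead of an expectation, because \<open>\<Phi> (W t)\<close> may fail to be integrable. The fourth sum is controlled by
  Markov's inequality for \<open>\<Sum> (W w - W u)\<^sup>2\<close>.

  The same inequality, applied to the difference of two step processes on a common refinement, is also
  what makes the Ito integral well behaved: if two sequences of step processes approximate \<open>X\<close> in
  \<open>L\<^sup>2[a,b]\<close> in probability, then the difference of their integrals tends to 0
  (\<open>approximations_have_close_integrals\<close>). This gives existence by a Cauchy argument, and it shows that the
  left-point sums converge to every version of the Ito integral.

  The mesh filter is reduced to sequences of partitions, because along a sequence a pathwise limit
  that holds almost surely is a limit in probability.\<close>

section \<open>Convergence in probability\<close>

context prob_space
begin

text \<open>Dominated convergence for the indicators.\<close>

lemma prob_tendsto_0_if_AE_eventually:
  assumes "\<And>k. A k \<in> events" and "AE \<omega> in M. \<forall>\<^sub>F k in sequentially. \<omega> \<notin> A k"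
  shows "(\<lambda>k. prob (A k)) \<longlonglongrightarrow> 0"
proof -
  have "(\<lambda>k. \<integral>\<omega>. indicator (A k) \<omega> \<partial>M) \<longlonglongrightarrow> (\<integral>\<omega>. 0 \<partial>M :: real)"
  proof (rule integral_dominated_convergence[where w = "\<lambda>_. 1"])
    show "AE \<omega> in M. (\<lambda>k. indicator (A k) \<omega> :: real) \<longlonglongrightarrow> 0"
      using assms(2)
    proof eventually_elim
      case (elim \<omega>)
      then have "\<forall>\<^sub>F k in sequentially. (indicator (A k) \<omega> :: real) = 0"
        by (rule eventually_mono) simp
      then show ?case by (rule tendsto_eventually)
    qed
  qed (use assms(1) in \<open>auto simp: indicator_def\<close>)
  then show ?thesis using assms(1) by simp
qed

lemma tendsto_in_probD:
  assumes "tendsto_in_prob M Y L F"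
  shows "\<forall>\<^sub>F i in F. Y i \<in> borel_measurable M" "L \<in> borel_measurable M"
    "\<epsilon> > 0 \<Longrightarrow> ((\<lambda>i. prob {\<omega> \<in> space M. \<bar>Y i \<omega> - L \<omega>\<bar> > \<epsilon>}) \<longlongrightarrow> 0) F"
  using assms by (auto simp: tendsto_in_prob_def)

lemma tendsto_in_probI:
  assumes "\<And>i. Y i \<in> borel_measurable M" "L \<in> borel_measurable M"
    "\<And>\<epsilon>. \<epsilon> > 0 \<Longrightarrow> ((\<lambda>i. prob {\<omega> \<in> space M. \<bar>Y i \<omega> - L \<omega>\<bar> > \<epsilon>}) \<longlongrightarrow> 0) F"
  shows "tendsto_in_prob M Y L F"
  using assms by (auto simp: tendsto_in_prob_def)

lemma tendsto_in_prob_if_AE: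
  assumes [measurable]: "\<And>k. Y k \<in> borel_measurable M" "L \<in> borel_measurable M"
    and "AE \<omega> in M. (\<lambda>k. Y k \<omega>) \<longlonglongrightarrow> L \<omega>"
  shows "tendsto_in_prob M Y L sequentially"
proof (rule tendsto_in_probI)
  fix \<epsilon> :: real assume "\<epsilon> > 0"
  show "(\<lambda>i. prob {\<omega> \<in> space M. \<bar>Y i \<omega> - L \<omega>\<bar> > \<epsilon>}) \<longlonglongrightarrow> 0"
  proof (rule prob_tendsto_0_if_AE_eventually)
    show "AE \<omega> in M. \<forall>\<^sub>F k in sequentially. \<omega> \<notin> {\<omega> \<in> space M. \<bar>Y k \<omega> - L \<omega>\<bar> > \<epsilon>}"
      using assms(3)
    proof eventually_elim
      case (elim \<omega>)
      from tendstoD[OF this \<open>\<epsilon> > 0\<close>] show ?case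
        by (rule eventually_mono) (auto simp: dist_real_def)
    qed
  qed measurable
qed fact+

lemma tendsto_in_prob_add:
  assumes Y: "tendsto_in_prob M Y L F" and Z: "tendsto_in_prob M Z K F"
  shows "tendsto_in_prob M (\<lambda>i \<omega>. Y i \<omega> + Z i \<omega>) (\<lambda>\<omega>. L \<omega> + K \<omega>) F"
  unfolding tendsto_in_prob_def
proof (intro conjI allI impI)
  note Y' = tendsto_in_probD[OF Y] and Z' = tendsto_in_probD[OF Z]
  note [measurable] = Y'(2) Z'(2)
  show "\<forall>\<^sub>F i in F. (\<lambda>\<omega>. Y i \<omega> + Z i \<omega>) \<in> borel_measurable M"
    using Y'(1) Z'(1) by eventually_elim measurable
  show "(\<lambda>\<omega>. L \<omega> + K \<omega>) \<in> borel_measurable M" by measurable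
  fix \<epsilon> :: real assume "\<epsilon> > 0"
  then have e: "\<epsilon> / 2 > 0" by simp
  have lim: "((\<lambda>i. prob {\<omega> \<in> space M. \<bar>Y i \<omega> - L \<omega>\<bar> > \<epsilon>/2} + prob {\<omega> \<in> space M. \<bar>Z i \<omega> - K \<omega>\<bar> > \<epsilon>/2}) \<longlongrightarrow> 0) F"
    using tendsto_add[OF Y'(3)[OF e] Z'(3)[OF e]] by simp
  have bd: "\<forall>\<^sub>F i in F. prob {\<omega> \<in> space M. \<bar>Y i \<omega> + Z i \<omega> - (L \<omega> + K \<omega>)\<bar> > \<epsilon>}
     \<le> prob {\<omega> \<in> space M. \<bar>Y i \<omega> - L \<omega>\<bar> > \<epsilon>/2} + prob {\<omega> \<in> space M. \<bar>Z i \<omega> - K \<omega>\<bar> > \<epsilon>/2}"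
    using Y'(1) Z'(1)
  proof eventually_elim
    case (elim i)
    note [measurable] = elim
    have "prob {\<omega> \<in> space M. \<bar>Y i \<omega> + Z i \<omega> - (L \<omega> + K \<omega>)\<bar> > \<epsilon>}
      \<le> prob ({\<omega> \<in> space M. \<bar>Y i \<omega> - L \<omega>\<bar> > \<epsilon>/2} \<union> {\<omega> \<in> space M. \<bar>Z i \<omega> - K \<omega>\<bar> > \<epsilon>/2})"
    proof (intro finite_measure_mono)
      have "\<epsilon> < \<bar>y + z - (l + k)\<bar> \<Longrightarrow> \<epsilon>/2 < \<bar>y - l\<bar> \<or> \<epsilon>/2 < \<bar>z - k\<bar>" for y z l k :: real by linarith
      then show "{\<omega> \<in> space M. \<bar>Y i \<omega> + Z i \<omega> - (L \<omega> + K \<omega>)\<bar> > \<epsilon>}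
        \<subseteq> {\<omega> \<in> space M. \<bar>Y i \<omega> - L \<omega>\<bar> > \<epsilon>/2} \<union> {\<omega> \<in> space M. \<bar>Z i \<omega> - K \<omega>\<bar> > \<epsilon>/2}" by blast
    qed measurable
    also have "\<dots> \<le> prob {\<omega> \<in> space M. \<bar>Y i \<omega> - L \<omega>\<bar> > \<epsilon>/2} + prob {\<omega> \<in> space M. \<bar>Z i \<omega> - K \<omega>\<bar> > \<epsilon>/2}"
      by (intro measure_Un_le) measurable
    finally show ?case .
  qed
  show "((\<lambda>i. prob {\<omega> \<in> space M. \<bar>Y i \<omega> + Z i \<omega> - (L \<omega> + K \<omega>)\<bar> > \<epsilon>}) \<longlongrightarrow> 0) F"
    by (rule tendsto_sandwich[OF _ bd tendsto_const lim]) simp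
qed

lemma tendsto_in_prob_cmult:
  assumes Y: "tendsto_in_prob M Y L F"
  shows "tendsto_in_prob M (\<lambda>i \<omega>. c * Y i \<omega>) (\<lambda>\<omega>. c * L \<omega>) F"
  unfolding tendsto_in_prob_def
proof (intro conjI allI impI)
  note Y' = tendsto_in_probD[OF Y]
  note [measurable] = Y'(2)
  show "\<forall>\<^sub>F i in F. (\<lambda>\<omega>. c * Y i \<omega>) \<in> borel_measurable M"
    using Y'(1) by eventually_elim measurable
  show "(\<lambda>\<omega>. c * L \<omega>) \<in> borel_measurable M" by measurable
  fix \<epsilon> :: real assume "\<epsilon> > 0"
  show "((\<lambda>i. prob {\<omega> \<in> space M. \<bar>c * Y i \<omega> - c * L \<omega>\<bar> > \<epsilon>}) \<longlongrightarrow> 0) F"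
  proof (cases "c = 0")
    case True
    then show ?thesis using \<open>\<epsilon> > 0\<close> by simp
  next
    case False
    have "{\<omega> \<in> space M. \<bar>c * Y i \<omega> - c * L \<omega>\<bar> > \<epsilon>} = {\<omega> \<in> space M. \<bar>Y i \<omega> - L \<omega>\<bar> > \<epsilon> / \<bar>c\<bar>}" for i
    proof -
      have "\<bar>c * Y i \<omega> - c * L \<omega>\<bar> = \<bar>Y i \<omega> - L \<omega>\<bar> * \<bar>c\<bar>" for \<omega>
        by (simp only: right_diff_distrib[symmetric] abs_mult mult.commute)
      then show ?thesis using False by (simp only: pos_divide_less_eq zero_less_abs_iff not_False_eq_True)
    qed
    then show ?thesis using Y'(3)[of "\<epsilon> / \<bar>c\<bar>"] \<open>\<epsilon> > 0\<close> False by simp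
  qed
qed

lemma tendsto_in_prob_diff:
  assumes "tendsto_in_prob M Y L F" and "tendsto_in_prob M Z K F"
  shows "tendsto_in_prob M (\<lambda>i \<omega>. Y i \<omega> - Z i \<omega>) (\<lambda>\<omega>. L \<omega> - K \<omega>) F"
  using tendsto_in_prob_add[OF assms(1) tendsto_in_prob_cmult[OF assms(2), of "-1"]] by simp

lemma tendsto_in_prob_0_dominated:
  assumes Z: "tendsto_in_prob M Z (\<lambda>_. 0) F"
    and Y: "\<And>i. Y i \<in> borel_measurable M" and le: "\<And>i. AE \<omega> in M. \<bar>Y i \<omega>\<bar> \<le> Z i \<omega>"
  shows "tendsto_in_prob M Y (\<lambda>_. 0) F"
proof (rule tendsto_in_probI)
  fix \<epsilon> :: real assume "\<epsilon> > 0"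
  note Z' = tendsto_in_probD[OF Z]
  note [measurable] = Y
  have bd: "\<forall>\<^sub>F i in F. prob {\<omega> \<in> space M. \<bar>Y i \<omega> - 0\<bar> > \<epsilon>} \<le> prob {\<omega> \<in> space M. \<bar>Z i \<omega> - 0\<bar> > \<epsilon>}"
    using Z'(1)
  proof eventually_elim
    case (elim i)
    note [measurable] = elim
    show ?case
      by (intro finite_measure_mono_AE) (use le[of i] in \<open>auto elim!: eventually_mono\<close>)
  qed
  show "((\<lambda>i. prob {\<omega> \<in> space M. \<bar>Y i \<omega> - 0\<bar> > \<epsilon>}) \<longlongrightarrow> 0) F"
    by (rule tendsto_sandwich[OF _ bd tendsto_const Z'(3)[OF \<open>\<epsilon> > 0\<close>]]) simp
qed (use Y in auto)

lemma tendsto_in_prob_unique: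
  assumes "F \<noteq> bot" and Y: "tendsto_in_prob M Y L F" and Y2: "tendsto_in_prob M Y K F"
  shows "AE \<omega> in M. L \<omega> = K \<omega>"
proof -
  have d: "tendsto_in_prob M (\<lambda>i \<omega>. 0) (\<lambda>\<omega>. L \<omega> - K \<omega>) F"
    using tendsto_in_prob_diff[OF Y Y2] by simp
  note [measurable] = tendsto_in_probD(2)[OF Y] tendsto_in_probD(2)[OF Y2]
  have "AE \<omega> in M. \<bar>L \<omega> - K \<omega>\<bar> \<le> 1 / Suc n" for n
  proof -
    have "((\<lambda>i. prob {\<omega> \<in> space M. \<bar>0 - (L \<omega> - K \<omega>)\<bar> > 1 / Suc n}) \<longlongrightarrow> 0) F"
      by (rule tendsto_in_probD(3)[OF d]) simp
    then have "prob {\<omega> \<in> space M. \<bar>0 - (L \<omega> - K \<omega>)\<bar> > 1 / Suc n} = 0"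
      using \<open>F \<noteq> bot\<close> by (simp add: tendsto_const_iff)
    then have "AE \<omega> in M. \<omega> \<notin> {\<omega> \<in> space M. \<bar>0 - (L \<omega> - K \<omega>)\<bar> > 1 / Suc n}"
      by (subst (asm) prob_eq_0) (auto simp: not_less)
    then show ?thesis by (auto elim!: eventually_mono)
  qed
  then have "AE \<omega> in M. \<forall>n. \<bar>L \<omega> - K \<omega>\<bar> \<le> 1 / Suc n" by (simp add: AE_all_countable)
  then show ?thesis
  proof eventually_elim
    case (elim \<omega>)
    have "\<bar>L \<omega> - K \<omega>\<bar> \<le> 0"
    proof (rule LIMSEQ_le_const)
      show "(\<lambda>n. 1 / real (Suc n)) \<longlonglongrightarrow> 0" by (rule LIMSEQ_Suc[OF lim_1_over_n])
    qed (use elim in auto)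
    then show ?case by simp
  qed
qed

text \<open>The form in which the martingale tail bound is used: first make \<open>\<delta>\<close> small against \<open>\<epsilon>\<^sup>2\<close>, then let \<open>k\<close> grow.\<close>

lemma tendsto_in_prob_0_if_bound:
  assumes Q: "tendsto_in_prob M Q (\<lambda>_. 0) sequentially"
    and Y: "\<And>k. Y k \<in> borel_measurable M"
    and bd: "\<And>k \<epsilon> \<delta>. \<epsilon> > 0 \<Longrightarrow> \<delta> > 0 \<Longrightarrow> prob {\<omega> \<in> space M. \<bar>Y k \<omega>\<bar> > \<epsilon>}
        \<le> prob {\<omega> \<in> space M. \<bar>Q k \<omega>\<bar> > \<delta>} + \<delta> / \<epsilon>\<^sup>2"
  shows "tendsto_in_prob M Y (\<lambda>_. 0) sequentially"
proof (rule tendsto_in_probI)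
  fix \<epsilon> :: real assume e: "\<epsilon> > 0"
  show "(\<lambda>k. prob {\<omega> \<in> space M. \<bar>Y k \<omega> - 0\<bar> > \<epsilon>}) \<longlonglongrightarrow> 0"
  proof (rule LIMSEQ_I)
    fix r :: real assume r: "r > 0"
    define \<delta> where "\<delta> = r * \<epsilon>\<^sup>2 / 2"
    have d: "\<delta> > 0" using r e by (simp add: \<delta>_def)
    have "(\<lambda>k. prob {\<omega> \<in> space M. \<bar>Q k \<omega> - 0\<bar> > \<delta>}) \<longlonglongrightarrow> 0"
      by (rule tendsto_in_probD(3)[OF Q d])
    from LIMSEQ_D[OF this, of "r/2"] r obtain N where
      N: "\<And>k. k \<ge> N \<Longrightarrow> prob {\<omega> \<in> space M. \<bar>Q k \<omega>\<bar> > \<delta>} < r / 2" by auto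
    have "\<delta> / \<epsilon>\<^sup>2 = r / 2" using e by (simp add: \<delta>_def)
    then have "prob {\<omega> \<in> space M. \<bar>Y k \<omega>\<bar> > \<epsilon>} < r" if "k \<ge> N" for k
      using bd[OF e d, of k] N[OF that] by linarith
    then have "norm (prob {\<omega> \<in> space M. \<bar>Y k \<omega> - 0\<bar> > \<epsilon>} - 0) < r" if "k \<ge> N" for k
      using that by (simp only: diff_0_right real_norm_def abs_of_nonneg measure_nonneg)
    then show "\<exists>no. \<forall>n\<ge>no. norm (prob {\<omega> \<in> space M. \<bar>Y n \<omega> - 0\<bar> > \<epsilon>} - 0) < r" by blast
  qed
qed (use Y in auto)

text \<open>Completeness. The Cauchy condition is phrased with two arbitrary index sequences tending to infinity because this is
  what a comparison of two approximating sequences delivers. A subsequence whose steps exceed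
  \<open>2\<^sup>-\<^sup>m\<close> with probability at most \<open>2\<^sup>-\<^sup>m\<close> converges almost surely by Borel-Cantelli, and the
  Cauchy condition carries its limit over to the whole sequence.\<close>

lemma tendsto_in_prob_if_Cauchy:
  assumes Y[measurable]: "\<And>k. Y k \<in> borel_measurable M"
    and cauchy: "\<And>p q :: nat \<Rightarrow> nat. filterlim p at_top sequentially \<Longrightarrow> filterlim q at_top sequentially \<Longrightarrow>
      tendsto_in_prob M (\<lambda>k \<omega>. Y (p k) \<omega> - Y (q k) \<omega>) (\<lambda>_. 0) sequentially"
  shows "\<exists>L. tendsto_in_prob M Y L sequentially"
proof -
  have "\<exists>N. \<forall>k\<ge>N. \<forall>l\<ge>N. prob {\<omega> \<in> space M. \<bar>Y k \<omega> - Y l \<omega>\<bar> > (1/2)^m} \<le> (1/2)^m" for m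
  proof (rule ccontr)
    assume "\<not> ?thesis"
    then have ex: "\<exists>k l. k \<ge> N \<and> l \<ge> N \<and> prob {\<omega> \<in> space M. \<bar>Y k \<omega> - Y l \<omega>\<bar> > (1/2)^m} > (1/2)^m" for N
      unfolding not_ex not_all not_imp not_le by blast
    define R where "R N k l \<longleftrightarrow> k \<ge> N \<and> l \<ge> N \<and> prob {\<omega> \<in> space M. \<bar>Y k \<omega> - Y l \<omega>\<bar> > (1/2)^m} > (1/2)^m"
      for N k l
    have "\<forall>N. \<exists>k l. R N k l" unfolding R_def using ex by blast
    then obtain p q where "\<And>N. R N (p N) (q N)" by metis
    then have pq: "\<And>N. p N \<ge> N" "\<And>N. q N \<ge> N"
      "\<And>N. prob {\<omega> \<in> space M. \<bar>Y (p N) \<omega> - Y (q N) \<omega>\<bar> > (1/2)^m} > (1/2)^m"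
      unfolding R_def by blast+
    have "filterlim p at_top sequentially" "filterlim q at_top sequentially"
      using pq(1,2) by (auto intro: filterlim_at_top_mono[OF filterlim_ident])
    from tendsto_in_probD(3)[OF cauchy[OF this], of "(1/2)^m"]
    have "(\<lambda>N. prob {\<omega> \<in> space M. \<bar>Y (p N) \<omega> - Y (q N) \<omega>\<bar> > (1/2)^m}) \<longlonglongrightarrow> 0" by simp
    then have "(1/2)^m \<le> (0::real)" by (rule LIMSEQ_le_const) (use pq(3) in \<open>auto intro: less_imp_le\<close>)
    moreover have "0 < (1/2::real)^m" by simp
    ultimately show False by linarith
  qed
  then have "\<exists>N. \<forall>m. \<forall>k\<ge>N m. \<forall>l\<ge>N m. prob {\<omega> \<in> space M. \<bar>Y k \<omega> - Y l \<omega>\<bar> > (1/2)^m} \<le> (1/2)^m"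
    by (intro choice allI)
  then obtain N where N: "\<And>m k l. k \<ge> N m \<Longrightarrow> l \<ge> N m \<Longrightarrow>
      prob {\<omega> \<in> space M. \<bar>Y k \<omega> - Y l \<omega>\<bar> > (1/2)^m} \<le> (1/2)^m" by blast
  \<comment> \<open>the summand \<open>m\<close> forces \<open>r\<close> to infinity even if all \<open>N i\<close> are 0\<close>
  define r where "r m = m + (\<Sum>i\<le>m. N i)" for m
  have r1: "r m \<ge> N m" for m
  proof -
    have "N m \<le> (\<Sum>i\<le>m. N i)" by (rule member_le_sum) auto
    then show ?thesis by (simp add: r_def)
  qed
  have r2: "r (Suc m) \<ge> N m" for m
    using r1[of m] by (simp add: r_def)
  have r3: "filterlim r at_top sequentially"
    by (rule filterlim_at_top_mono[OF filterlim_ident]) (simp add: r_def)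
  define A where "A m = {\<omega> \<in> space M. \<bar>Y (r (Suc m)) \<omega> - Y (r m) \<omega>\<bar> > (1/2)^m}" for m
  have A[measurable]: "A m \<in> events" for m unfolding A_def by measurable
  have "AE \<omega> in M. \<forall>\<^sub>F m in sequentially. \<omega> \<in> space M - A m"
  proof (rule borel_cantelli_AE1)
    show "summable (\<lambda>m. prob (A m))"
      by (rule summable_comparison_test'[OF summable_geometric[of "1/2::real"], of 0])
         (use N[OF r2 r1] in \<open>auto simp: A_def\<close>)
  qed (auto simp: less_top[symmetric])
  then have conv: "AE \<omega> in M. convergent (\<lambda>m. Y (r m) \<omega>)"
  proof (eventually_elim)
    case (elim \<omega>)
    then have "\<forall>\<^sub>F m in sequentially. norm (Y (r (Suc m)) \<omega> - Y (r m) \<omega>) \<le> (1/2)^m"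
      by (rule eventually_mono) (auto simp: A_def)
    then have "summable (\<lambda>m. Y (r (Suc m)) \<omega> - Y (r m) \<omega>)"
      by (rule summable_comparison_test_ev) (rule summable_geometric, simp)
    then have "convergent (\<lambda>m. \<Sum>i<m. (Y (r (Suc i)) \<omega> - Y (r i) \<omega>))"
      by (simp add: summable_iff_convergent)
    then have "convergent (\<lambda>m. Y (r m) \<omega> - Y (r 0) \<omega>)"
      by (simp add: sum_lessThan_telescope[where f="\<lambda>i. Y (r i) \<omega>"])
    from convergent_add[OF this convergent_const[of "Y (r 0) \<omega>"]] show ?case by simp
  qed
  define L where "L \<omega> = lim (\<lambda>m. Y (r m) \<omega>)" for \<omega>
  have "tendsto_in_prob M (\<lambda>m. Y (r m)) L sequentially"
  proof (rule tendsto_in_prob_if_AE)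
    show "L \<in> borel_measurable M" unfolding L_def by measurable
    show "AE \<omega> in M. (\<lambda>k. Y (r k) \<omega>) \<longlonglongrightarrow> L \<omega>"
      using conv by eventually_elim (simp add: L_def convergent_LIMSEQ_iff)
  qed measurable
  from tendsto_in_prob_add[OF this cauchy[OF filterlim_ident r3]]
  show ?thesis by auto
qed

end

section \<open>Martingale transforms\<close>

text \<open>The Ito isometry in discrete time. The cross terms vanish because everything before \<open>d j\<close> is
  measurable for \<open>F j\<close>, hence independent of the centred variable \<open>d j\<close>. The premises relate only
  indices below \<open>n\<close>, because the points of a partition beyond the last one are arbitrary.\<close>

lemma (in prob_space) martingale_transform_second_moment:
  fixes \<xi> d :: "nat \<Rightarrow> 'a \<Rightarrow> real" and v :: "nat \<Rightarrow> real"
  assumes F: "\<And>j. j < n \<Longrightarrow> sets (F j) \<subseteq> events \<and> space (F j) = space M"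
    and xi: "\<And>i j. i \<le> j \<Longrightarrow> j < n \<Longrightarrow> \<xi> i \<in> borel_measurable (F j)"
    and d: "\<And>i j. i < j \<Longrightarrow> j < n \<Longrightarrow> d i \<in> borel_measurable (F j)"
    and dM: "\<And>j. j < n \<Longrightarrow> d j \<in> borel_measurable M"
    and indep: "\<And>j X. j < n \<Longrightarrow> X \<in> borel_measurable (F j) \<Longrightarrow> indep_var borel X borel (d j)"
    and int: "\<And>j. j < n \<Longrightarrow> integrable M (\<lambda>\<omega>. (d j \<omega>)\<^sup>2)"
    and mean: "\<And>j. j < n \<Longrightarrow> expectation (d j) = 0"
    and var: "\<And>j. j < n \<Longrightarrow> expectation (\<lambda>\<omega>. (d j \<omega>)\<^sup>2) = v j"
    and xi_int: "\<And>j. j < n \<Longrightarrow> integrable M (\<lambda>\<omega>. (\<xi> j \<omega>)\<^sup>2)"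
  shows "integrable M (\<lambda>\<omega>. (\<Sum>j<n. \<xi> j \<omega> * d j \<omega>)\<^sup>2) \<and>
    expectation (\<lambda>\<omega>. (\<Sum>j<n. \<xi> j \<omega> * d j \<omega>)\<^sup>2) = (\<Sum>j<n. expectation (\<lambda>\<omega>. (\<xi> j \<omega>)\<^sup>2) * v j)"
proof -
  have sub: "X \<in> borel_measurable M" if "j < n" "X \<in> borel_measurable (F j)" for j and X :: "'a \<Rightarrow> real"
    using F[OF that(1)] that(2) by (auto simp: measurable_def)
  have "m \<le> n \<Longrightarrow> integrable M (\<lambda>\<omega>. (\<Sum>j<m. \<xi> j \<omega> * d j \<omega>)\<^sup>2) \<and>
    expectation (\<lambda>\<omega>. (\<Sum>j<m. \<xi> j \<omega> * d j \<omega>)\<^sup>2) = (\<Sum>j<m. expectation (\<lambda>\<omega>. (\<xi> j \<omega>)\<^sup>2) * v j)" for m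
  proof (induction m)
    case (Suc m)
    then have m: "m < n" by simp
    define S where "S \<omega> = (\<Sum>j<m. \<xi> j \<omega> * d j \<omega>)" for \<omega>
    have SF: "S \<in> borel_measurable (F m)"
      unfolding S_def using m by (intro borel_measurable_sum borel_measurable_times xi d) auto
    have xF: "\<xi> m \<in> borel_measurable (F m)" using xi[of m m] m by simp
    note [measurable] = SF xF sub[OF m SF] sub[OF m xF] dM[OF m]
    have IH: "integrable M (\<lambda>\<omega>. (S \<omega>)\<^sup>2)" "expectation (\<lambda>\<omega>. (S \<omega>)\<^sup>2) = (\<Sum>j<m. expectation (\<lambda>\<omega>. (\<xi> j \<omega>)\<^sup>2) * v j)"
      using Suc.IH m by (auto simp: S_def)
    have iSx: "integrable M (\<lambda>\<omega>. S \<omega> * \<xi> m \<omega>)"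
    proof (rule Bochner_Integration.integrable_bound)
      show "integrable M (\<lambda>\<omega>. (S \<omega>)\<^sup>2 + (\<xi> m \<omega>)\<^sup>2)" using IH(1) xi_int[OF m] by simp
      have "\<bar>x * y\<bar> \<le> x\<^sup>2 + y\<^sup>2" for x y :: real
        using sum_squares_bound[of "\<bar>x\<bar>" "\<bar>y\<bar>"] abs_ge_zero[of "x * y"] unfolding abs_mult power2_abs by linarith
      then show "AE \<omega> in M. norm (S \<omega> * \<xi> m \<omega>) \<le> norm ((S \<omega>)\<^sup>2 + (\<xi> m \<omega>)\<^sup>2)" by simp
    qed measurable
    have id: "integrable M (d m)"
      by (rule square_integrable_imp_integrable[OF _ int[OF m]]) measurable
    have ind1: "indep_var borel (\<lambda>\<omega>. S \<omega> * \<xi> m \<omega>) borel (d m)"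
      by (rule indep[OF m]) measurable
    have "indep_var borel (\<lambda>\<omega>. (\<xi> m \<omega>)\<^sup>2) borel ((\<lambda>x. x\<^sup>2) \<circ> d m)"
      using indep_var_compose[OF indep[OF m xF], of "\<lambda>x. x\<^sup>2" borel "\<lambda>x. x\<^sup>2" borel] by (simp add: comp_def)
    then have ind2: "indep_var borel (\<lambda>\<omega>. (\<xi> m \<omega>)\<^sup>2) borel (\<lambda>\<omega>. (d m \<omega>)\<^sup>2)" by (simp add: comp_def)
    note c1 = indep_var_integrable[OF ind1 iSx id] indep_var_lebesgue_integral[OF ind1 iSx id]
    note c2 = indep_var_integrable[OF ind2 xi_int[OF m] int[OF m]] indep_var_lebesgue_integral[OF ind2 xi_int[OF m] int[OF m]]
    have eq: "(\<Sum>j<Suc m. \<xi> j \<omega> * d j \<omega>)\<^sup>2 = (S \<omega>)\<^sup>2 + 2 * (S \<omega> * \<xi> m \<omega> * d m \<omega>) + (\<xi> m \<omega>)\<^sup>2 * (d m \<omega>)\<^sup>2" for \<omega>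
      by (simp add: S_def power2_eq_square algebra_simps)
    show ?case unfolding eq using IH c1 c2 mean[OF m] var[OF m] by simp
  qed simp
  then show ?thesis by blast
qed

text \<open>Each \<open>\<xi> j\<close> is set to 0 once the accumulated \<open>\<Sum> (\<xi> i)\<^sup>2 v i\<close> exceeds \<open>\<delta>\<close>. This decision is known at step \<open>j\<close>,
  the truncated sum has second moment at most \<open>\<delta>\<close> by the isometry, and it agrees with the
  original sum wherever the total stays below \<open>\<delta>\<close>; the rest is Markov's inequality.\<close>

lemma (in prob_space) martingale_transform_tail_bound:
  fixes \<xi> d :: "nat \<Rightarrow> 'a \<Rightarrow> real" and v :: "nat \<Rightarrow> real"
  assumes F: "\<And>j. j < n \<Longrightarrow> sets (F j) \<subseteq> events \<and> space (F j) = space M"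
    and xi: "\<And>i j. i \<le> j \<Longrightarrow> j < n \<Longrightarrow> \<xi> i \<in> borel_measurable (F j)"
    and d: "\<And>i j. i < j \<Longrightarrow> j < n \<Longrightarrow> d i \<in> borel_measurable (F j)"
    and dM: "\<And>j. j < n \<Longrightarrow> d j \<in> borel_measurable M"
    and indep: "\<And>j X. j < n \<Longrightarrow> X \<in> borel_measurable (F j) \<Longrightarrow> indep_var borel X borel (d j)"
    and int: "\<And>j. j < n \<Longrightarrow> integrable M (\<lambda>\<omega>. (d j \<omega>)\<^sup>2)"
    and mean: "\<And>j. j < n \<Longrightarrow> expectation (d j) = 0"
    and var: "\<And>j. j < n \<Longrightarrow> expectation (\<lambda>\<omega>. (d j \<omega>)\<^sup>2) = v j"
    and v: "\<And>j. j < n \<Longrightarrow> v j > 0"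
    and pos: "\<delta> > 0" "\<epsilon> > 0"
  shows "prob {\<omega> \<in> space M. \<bar>\<Sum>j<n. \<xi> j \<omega> * d j \<omega>\<bar> > \<epsilon>}
    \<le> prob {\<omega> \<in> space M. (\<Sum>j<n. (\<xi> j \<omega>)\<^sup>2 * v j) > \<delta>} + \<delta> / \<epsilon>\<^sup>2"
proof -
  have sub: "X \<in> borel_measurable M" if "j < n" "X \<in> borel_measurable (F j)" for j and X :: "'a \<Rightarrow> real"
    using F[OF that(1)] that(2) by (auto simp: measurable_def)
  have xM: "\<xi> j \<in> borel_measurable M" if "j < n" for j using sub[OF that xi[OF _ that]] by simp
  \<comment> \<open>the sum up to and including index \<open>j\<close>, so that \<open>\<eta> j\<close> is bounded as well\<close>
  define V where "V j \<omega> = (\<Sum>i\<le>j. (\<xi> i \<omega>)\<^sup>2 * v i)" for j \<omega>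
  define \<eta> where "\<eta> j \<omega> = (if V j \<omega> \<le> \<delta> then \<xi> j \<omega> else 0)" for j \<omega>
  have VF: "V i \<in> borel_measurable (F j)" if "i \<le> j" "j < n" for i j
    unfolding V_def using that by (intro borel_measurable_sum borel_measurable_times borel_measurable_power xi) auto
  have eF: "\<eta> i \<in> borel_measurable (F j)" if "i \<le> j" "j < n" for i j
  proof -
    note [measurable] = VF[OF that] xi[OF that]
    show ?thesis unfolding \<eta>_def by measurable
  qed
  have eM: "\<eta> j \<in> borel_measurable M" if "j < n" for j using sub[OF that eF[OF _ that]] by simp
  have sq_le: "(\<eta> j \<omega>)\<^sup>2 * v j \<le> \<delta>" if "j < n" for j \<omega>
  proof (cases "V j \<omega> \<le> \<delta>")
    case True
    have "(\<xi> j \<omega>)\<^sup>2 * v j \<le> V j \<omega>" unfolding V_def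
      by (rule member_le_sum) (use that in \<open>auto intro!: mult_nonneg_nonneg less_imp_le[OF v]\<close>)
    then show ?thesis using True by (simp add: \<eta>_def)
  qed (use pos in \<open>simp add: \<eta>_def\<close>)
  have sum_le: "m \<le> n \<Longrightarrow> (\<Sum>j<m. (\<eta> j \<omega>)\<^sup>2 * v j) \<le> \<delta> \<and> (\<Sum>j<m. (\<eta> j \<omega>)\<^sup>2 * v j) \<le> (\<Sum>j<m. (\<xi> j \<omega>)\<^sup>2 * v j)" for m \<omega>
  proof (induction m)
    case (Suc m)
    show ?case
    proof (cases "V m \<omega> \<le> \<delta>")
      case True
      have "(\<xi> m \<omega>)\<^sup>2 * v m + (\<Sum>j<m. (\<xi> j \<omega>)\<^sup>2 * v j) = V m \<omega>"
        by (simp add: V_def lessThan_Suc_atMost[symmetric])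
      then show ?thesis using Suc True by (auto simp: \<eta>_def)
    next
      case False
      have "0 \<le> (\<xi> m \<omega>)\<^sup>2 * v m" using v[of m] Suc.prems by simp
      then show ?thesis using Suc False by (auto simp: \<eta>_def)
    qed
  qed (use pos in simp)
  have eint: "integrable M (\<lambda>\<omega>. (\<eta> j \<omega>)\<^sup>2)" if "j < n" for j
  proof (rule integrable_const_bound[where B = "\<delta> / v j"])
    show "AE \<omega> in M. norm ((\<eta> j \<omega>)\<^sup>2) \<le> \<delta> / v j"
      using sq_le[OF that] v[OF that] by (simp add: field_simps)
    show "(\<lambda>\<omega>. (\<eta> j \<omega>)\<^sup>2) \<in> borel_measurable M" using eM[OF that] by measurable
  qed
  define S where "S \<omega> = (\<Sum>j<n. \<eta> j \<omega> * d j \<omega>)" for \<omega>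
  have S[measurable]: "S \<in> borel_measurable M" unfolding S_def
    by (intro borel_measurable_sum borel_measurable_times eM dM) auto
  have ito: "integrable M (\<lambda>\<omega>. (S \<omega>)\<^sup>2)" "expectation (\<lambda>\<omega>. (S \<omega>)\<^sup>2) = (\<Sum>j<n. expectation (\<lambda>\<omega>. (\<eta> j \<omega>)\<^sup>2) * v j)"
  proof -
    have "integrable M (\<lambda>\<omega>. (S \<omega>)\<^sup>2) \<and>
      expectation (\<lambda>\<omega>. (S \<omega>)\<^sup>2) = (\<Sum>j<n. expectation (\<lambda>\<omega>. (\<eta> j \<omega>)\<^sup>2) * v j)"
      unfolding S_def by (rule martingale_transform_second_moment[of n F \<eta> d v]) (fact F eF d dM indep int mean var eint)+
    then show "integrable M (\<lambda>\<omega>. (S \<omega>)\<^sup>2)"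
      "expectation (\<lambda>\<omega>. (S \<omega>)\<^sup>2) = (\<Sum>j<n. expectation (\<lambda>\<omega>. (\<eta> j \<omega>)\<^sup>2) * v j)" by blast+
  qed
  have "(\<Sum>j<n. expectation (\<lambda>\<omega>. (\<eta> j \<omega>)\<^sup>2) * v j) = expectation (\<lambda>\<omega>. \<Sum>j<n. (\<eta> j \<omega>)\<^sup>2 * v j)"
    using eint by (subst Bochner_Integration.integral_sum) auto
  also have "\<dots> \<le> expectation (\<lambda>_. \<delta>)"
    using eint sum_le[of n] by (intro integral_mono Bochner_Integration.integrable_sum) auto
  finally have E: "expectation (\<lambda>\<omega>. (S \<omega>)\<^sup>2) \<le> \<delta>" using ito by (simp add: prob_space)
  have "prob {\<omega> \<in> space M. \<bar>S \<omega>\<bar> > \<epsilon>} \<le> prob {\<omega> \<in> space M. (S \<omega>)\<^sup>2 \<ge> \<epsilon>\<^sup>2}"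
    using pos by (intro finite_measure_mono) (auto simp: abs_le_square_iff[symmetric])
  also have "\<dots> \<le> expectation (\<lambda>\<omega>. (S \<omega>)\<^sup>2) / \<epsilon>\<^sup>2"
    using integral_Markov_inequality_measure[where A = "{}" and u="\<lambda>\<omega>. (S \<omega>)\<^sup>2" and c = "\<epsilon>\<^sup>2"] ito(1) pos by simp
  also have "\<dots> \<le> \<delta> / \<epsilon>\<^sup>2" using E pos by (simp add: divide_right_mono)
  finally have P1: "prob {\<omega> \<in> space M. \<bar>S \<omega>\<bar> > \<epsilon>} \<le> \<delta> / \<epsilon>\<^sup>2" .
  have same: "S \<omega> = (\<Sum>j<n. \<xi> j \<omega> * d j \<omega>)" if "(\<Sum>j<n. (\<xi> j \<omega>)\<^sup>2 * v j) \<le> \<delta>" for \<omega>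
    unfolding S_def
  proof (rule sum.cong[OF refl])
    fix j assume "j \<in> {..<n}"
    then have "V j \<omega> \<le> (\<Sum>j<n. (\<xi> j \<omega>)\<^sup>2 * v j)" unfolding V_def
      by (intro sum_mono2) (auto intro!: mult_nonneg_nonneg less_imp_le[OF v])
    then show "\<eta> j \<omega> * d j \<omega> = \<xi> j \<omega> * d j \<omega>" using that by (simp add: \<eta>_def)
  qed
  have [measurable]: "(\<lambda>\<omega>. \<Sum>j<n. (\<xi> j \<omega>)\<^sup>2 * v j) \<in> borel_measurable M"
    by (intro borel_measurable_sum borel_measurable_times borel_measurable_power xM) auto
  have "prob {\<omega> \<in> space M. \<bar>\<Sum>j<n. \<xi> j \<omega> * d j \<omega>\<bar> > \<epsilon>}
    \<le> prob ({\<omega> \<in> space M. (\<Sum>j<n. (\<xi> j \<omega>)\<^sup>2 * v j) > \<delta>} \<union> {\<omega> \<in> space M. \<bar>S \<omega>\<bar> > \<epsilon>})"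
  proof (intro finite_measure_mono subsetI)
    fix \<omega> assume w: "\<omega> \<in> {\<omega> \<in> space M. \<bar>\<Sum>j<n. \<xi> j \<omega> * d j \<omega>\<bar> > \<epsilon>}"
    show "\<omega> \<in> {\<omega> \<in> space M. (\<Sum>j<n. (\<xi> j \<omega>)\<^sup>2 * v j) > \<delta>} \<union> {\<omega> \<in> space M. \<bar>S \<omega>\<bar> > \<epsilon>}"
    proof (cases "(\<Sum>j<n. (\<xi> j \<omega>)\<^sup>2 * v j) \<le> \<delta>")
      case True
      then show ?thesis using w same[OF True] by simp
    qed (use w in simp)
  qed measurable
  also have "\<dots> \<le> prob {\<omega> \<in> space M. (\<Sum>j<n. (\<xi> j \<omega>)\<^sup>2 * v j) > \<delta>} + prob {\<omega> \<in> space M. \<bar>S \<omega>\<bar> > \<epsilon>}"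
    by (intro measure_Un_le) measurable
  finally show ?thesis using P1 by simp
qed

section \<open>Partitions and step functions\<close>

lemma partition_less:
  assumes "(n, t) \<in> partitions a b" "i < j" "j \<le> n"
  shows "t i < t j"
  using assms(2,3)
proof (induction j)
  case (Suc j)
  have "t j < t (Suc j)" using assms(1) Suc.prems by (auto simp: partitions_def)
  then show ?case using Suc by (cases "i = j") auto
qed simp

lemma partition_mono:
  assumes "(n, t) \<in> partitions a b" "i \<le> j" "j \<le> n"
  shows "t i \<le> t j"
  using partition_less[OF assms(1), of i j] assms(2,3) by (cases "i = j") auto

lemma partition_bounds:
  assumes "(n, t) \<in> partitions a b" "i \<le> n"
  shows "a \<le> t i" "t i \<le> b"
  using partition_mono[OF assms(1), of 0 i] partition_mono[OF assms(1), of i n] assms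
  by (auto simp: partitions_def)

lemma partition_of_finite_set:
  fixes a b :: real
  assumes "finite T" "a \<in> T" "b \<in> T" "T \<subseteq> {a..b}"
  obtains n t where "(n, t) \<in> partitions a b" "t ` {..n} = T"
proof -
  define xs where "xs = sorted_list_of_set T"
  have xs: "set xs = T" "sorted_wrt (<) xs" using assms(1) by (simp_all add: xs_def)
  define n where "n = length xs - 1"
  have len: "length xs = Suc n" using xs(1) assms(2) by (cases xs) (auto simp: n_def)
  have img: "(\<lambda>i. xs ! i) ` {..n} = T"
    using xs(1) len by (auto simp: set_conv_nth less_Suc_eq_le image_iff)
  have mono: "xs ! i < xs ! j" if "i < j" "j \<le> n" for i j
    using sorted_wrt_nth_less[OF xs(2), of i j] that len by simp
  have "xs ! 0 = a"
  proof -
    obtain i where "i \<le> n" "xs ! i = a" using img assms(2) by auto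
    moreover have "a \<le> xs ! 0" using img assms(4) by auto
    ultimately show ?thesis using mono[of 0 i] by (cases "i = 0") auto
  qed
  moreover have "xs ! n = b"
  proof -
    obtain i where "i \<le> n" "xs ! i = b" using img assms(3) by auto
    moreover have "xs ! n \<le> b" using img assms(4) by auto
    ultimately show ?thesis using mono[of i n] by (cases "i = n") auto
  qed
  ultimately have "(n, \<lambda>i. xs ! i) \<in> partitions a b" using mono by (auto simp: partitions_def)
  then show thesis using img that by blast
qed

definition step_fun :: "nat \<Rightarrow> (nat \<Rightarrow> real) \<Rightarrow> (nat \<Rightarrow> real) \<Rightarrow> real \<Rightarrow> real" where
  "step_fun n s c t = (\<Sum>j<n. c j * indicator {s j<..s (Suc j)} t)"

lemma simple_eval_step_fun: "simple_eval (n, s, \<xi>) t \<omega> = step_fun n s (\<lambda>j. \<xi> j \<omega>) t"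
  by (simp add: simple_eval_def step_fun_def)

lemma partition_cell_unique:
  assumes "(n, s) \<in> partitions a b" "i < n" "j < n" "t \<in> {s i<..s (Suc i)}" "t \<in> {s j<..s (Suc j)}"
  shows "i = j"
proof (rule ccontr)
  assume "i \<noteq> j"
  then have "Suc i \<le> j \<or> Suc j \<le> i" by auto
  then show False
    using partition_mono[OF assms(1), of "Suc i" j] partition_mono[OF assms(1), of "Suc j" i] assms by auto
qed

lemma partition_cell_exists:
  assumes "(n, s) \<in> partitions a b" "t \<in> {a<..b}"
  obtains j where "j < n" "t \<in> {s j<..s (Suc j)}"
proof -
  define P where "P i \<longleftrightarrow> t \<le> s i" for i
  have "P n" "\<not> P 0" using assms by (auto simp: P_def partitions_def)
  then obtain j where "j < n" "\<not> P j" "P (Suc j)"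
    using ex_least_nat_less[of P n] by (metis less_eq_Suc_le order_refl)
  then show thesis using that[of j] by (auto simp: P_def)
qed

lemma partition_cell_subset:
  assumes "(n, s) \<in> partitions a b" "j < n"
  shows "{s j<..s (Suc j)} \<subseteq> {a<..b}"
  using partition_bounds[OF assms(1), of j] partition_bounds[OF assms(1), of "Suc j"] assms(2) by auto

lemma step_fun_cell:
  assumes "(n, s) \<in> partitions a b" "j < n" "t \<in> {s j<..s (Suc j)}"
  shows "step_fun n s c t = c j"
proof -
  have "step_fun n s c t = (\<Sum>i<n. if i = j then c j else 0)"
    unfolding step_fun_def
  proof (rule sum.cong[OF refl])
    fix i assume "i \<in> {..<n}"
    then have "t \<in> {s i<..s (Suc i)} \<longleftrightarrow> i = j"
      using partition_cell_unique[OF assms(1) _ assms(2) _ assms(3)] assms(3) by blast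
    then show "c i * indicator {s i<..s (Suc i)} t = (if i = j then c j else 0)"
      by (simp only: indicator_def) simp
  qed
  then show ?thesis using assms(2) by simp
qed

lemma step_fun_outside:
  assumes "(n, s) \<in> partitions a b" "t \<notin> {a<..b}"
  shows "step_fun n s c t = 0"
  unfolding step_fun_def
proof (rule sum.neutral, rule ballI)
  fix j assume "j \<in> {..<n}"
  then have "t \<notin> {s j<..s (Suc j)}" using partition_cell_subset[OF assms(1), of j] assms(2) by blast
  then show "c j * indicator {s j<..s (Suc j)} t = 0" by simp
qed

text \<open>At most one summand of a step function is nonzero at any point, so functions vanishing at 0 act on the
  values. Squaring is the case of interest.\<close>

lemma step_fun_map:
  assumes "(n, s) \<in> partitions a b" "f 0 = 0"
  shows "f (step_fun n s c t) = step_fun n s (\<lambda>j. f (c j)) t"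
proof (cases "t \<in> {a<..b}")
  case True
  then obtain j where "j < n" "t \<in> {s j<..s (Suc j)}" using partition_cell_exists[OF assms(1)] by blast
  then show ?thesis using step_fun_cell[OF assms(1)] by simp
qed (simp add: step_fun_outside[OF assms(1)] assms(2))

lemma step_fun_measurable [measurable]: "step_fun n s c \<in> borel_measurable borel"
  unfolding step_fun_def by measurable

lemma integrable_cell: "integrable lborel (\<lambda>t. c * indicator {x<..y::real} t :: real)"
  by (cases "x \<le> y") (auto intro!: integrable_mult_right integrable_real_indicator)

lemma step_fun_integral:
  assumes p: "(n, s) \<in> partitions a b"
  shows "set_integrable lborel {a..b} (step_fun n s c)"
    and "(LBINT t:{a..b}. step_fun n s c t) = (\<Sum>j<n. c j * (s (Suc j) - s j))"
proof -
  have eq: "indicator {a..b} t *\<^sub>R step_fun n s c t = (\<Sum>j<n. c j * indicator {s j<..s (Suc j)} t)" for t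
  proof (cases "t \<in> {a<..b}")
    case True
    then show ?thesis by (simp add: step_fun_def)
  next
    case False
    then show ?thesis using step_fun_outside[OF p False, of c] by (simp add: step_fun_def)
  qed
  have int: "integrable lborel (\<lambda>t. c j * indicator {s j<..s (Suc j)} t)" for j
    by (rule integrable_cell)
  show "set_integrable lborel {a..b} (step_fun n s c)"
    unfolding set_integrable_def eq by (intro Bochner_Integration.integrable_sum int)
  have "s j \<le> s (Suc j)" if "j < n" for j using partition_mono[OF p, of j "Suc j"] that by simp
  then show "(LBINT t:{a..b}. step_fun n s c t) = (\<Sum>j<n. c j * (s (Suc j) - s j))"
    unfolding set_lebesgue_integral_def eq using int by (subst Bochner_Integration.integral_sum) auto
qed

lemma refinement_cell:
  assumes p: "(n, s) \<in> partitions a b" and q: "(N, u) \<in> partitions a b" and sub: "s ` {..n} \<subseteq> u ` {..N}" and i: "i < N"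
  obtains j where "j < n" "s j \<le> u i" "u (Suc i) \<le> s (Suc j)"
proof -
  have "u (Suc i) \<in> {a<..b}"
    using partition_less[OF q, of 0 "Suc i"] partition_bounds[OF q, of "Suc i"] q i by (auto simp: partitions_def)
  then obtain j where j: "j < n" "u (Suc i) \<in> {s j<..s (Suc j)}" using partition_cell_exists[OF p] by blast
  have "s j \<in> u ` {..N}" using sub j(1) by (simp add: subset_iff)
  then obtain k where k: "k \<le> N" "s j = u k" by blast
  have "k \<le> i"
  proof (rule ccontr)
    assume "\<not> k \<le> i"
    then have "u (Suc i) \<le> u k" using partition_mono[OF q, of "Suc i" k] k by simp
    then show False using j k by simp
  qed
  then have "s j \<le> u i" using partition_mono[OF q, of k i] i k by simp
  then show thesis using that j by auto
qed

text \<open>The value on a refined cell is read off at its right end point, since cells are open on the left.\<close>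

lemma step_fun_refine:
  assumes p: "(n, s) \<in> partitions a b" and q: "(N, u) \<in> partitions a b" and sub: "s ` {..n} \<subseteq> u ` {..N}"
  shows "step_fun n s c t = step_fun N u (\<lambda>i. step_fun n s c (u (Suc i))) t"
proof (cases "t \<in> {a<..b}")
  case True
  then obtain i where i: "i < N" "t \<in> {u i<..u (Suc i)}" using partition_cell_exists[OF q] by blast
  obtain j where j: "j < n" "s j \<le> u i" "u (Suc i) \<le> s (Suc j)" by (rule refinement_cell[OF p q sub i(1)])
  have "step_fun n s c t = c j" by (rule step_fun_cell[OF p j(1)]) (use i j in auto)
  moreover have "step_fun n s c (u (Suc i)) = c j"
    by (rule step_fun_cell[OF p j(1)]) (use i j partition_less[OF q, of i "Suc i"] in auto)
  ultimately show ?thesis using step_fun_cell[OF q i] by simp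
qed (simp add: step_fun_outside[OF p] step_fun_outside[OF q])

text \<open>For each coarse cell the fine increments inside it telescope. The integrator \<open>g\<close> will be a Brownian path.\<close>

lemma step_sum_refine:
  fixes g :: "real \<Rightarrow> real"
  assumes p: "(n, s) \<in> partitions a b" and q: "(N, u) \<in> partitions a b" and sub: "s ` {..n} \<subseteq> u ` {..N}"
  shows "(\<Sum>j<n. c j * (g (s (Suc j)) - g (s j))) = (\<Sum>i<N. step_fun n s c (u (Suc i)) * (g (u (Suc i)) - g (u i)))"
proof -
  have cell: "(\<Sum>i<N. indicator {s j<..s (Suc j)} (u (Suc i)) * (g (u (Suc i)) - g (u i))) = g (s (Suc j)) - g (s j)"
    if j: "j < n" for j
  proof -
    have "s j \<in> u ` {..N}" "s (Suc j) \<in> u ` {..N}" using sub j by (simp_all add: subset_iff)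
    then obtain k l where k: "k \<le> N" "s j = u k" and l: "l \<le> N" "s (Suc j) = u l" by blast
    have lt: "u x < u y \<longleftrightarrow> x < y" if "x \<le> N" "y \<le> N" for x y
      using partition_less[OF q, of x y] partition_mono[OF q, of y x] that by (meson not_le)
    have "k \<le> l" using partition_less[OF p, of j "Suc j"] j k l lt[of k l] by simp
    have ind: "(indicator {s j<..s (Suc j)} (u (Suc i)) :: real) = (if i \<in> {k..<l} then 1 else 0)" if "i < N" for i
    proof -
      have "u k < u (Suc i) \<longleftrightarrow> k \<le> i" using lt[of k "Suc i"] k that by auto
      moreover have "u (Suc i) \<le> u l \<longleftrightarrow> i < l" using lt[of l "Suc i"] l that by (auto simp: not_less[symmetric])
      ultimately show ?thesis by (simp add: indicator_def k l)
    qed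
    have "(\<Sum>i<N. indicator {s j<..s (Suc j)} (u (Suc i)) * (g (u (Suc i)) - g (u i)))
      = (\<Sum>i<N. if i \<in> {k..<l} then g (u (Suc i)) - g (u i) else 0)"
      by (rule sum.cong) (auto simp: ind)
    also have "\<dots> = (\<Sum>i\<in>{..<N} \<inter> {k..<l}. g (u (Suc i)) - g (u i))"
      by (simp add: sum.inter_restrict)
    also have "{..<N} \<inter> {k..<l} = {k..<l}" using l by auto
    also have "(\<Sum>i\<in>{k..<l}. g (u (Suc i)) - g (u i)) = g (u l) - g (u k)"
      using \<open>k \<le> l\<close> by (rule sum_Suc_diff'[of k l "\<lambda>i. g (u i)"])
    finally show ?thesis using k l by simp
  qed
  have "(\<Sum>i<N. step_fun n s c (u (Suc i)) * (g (u (Suc i)) - g (u i)))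
    = (\<Sum>i<N. \<Sum>j<n. c j * (indicator {s j<..s (Suc j)} (u (Suc i)) * (g (u (Suc i)) - g (u i))))"
    by (simp only: step_fun_def sum_distrib_right mult.assoc)
  also have "\<dots> = (\<Sum>j<n. c j * (\<Sum>i<N. indicator {s j<..s (Suc j)} (u (Suc i)) * (g (u (Suc i)) - g (u i))))"
    by (subst sum.swap) (simp only: sum_distrib_left)
  also have "\<dots> = (\<Sum>j<n. c j * (g (s (Suc j)) - g (s j)))" using cell by simp
  finally show ?thesis by simp
qed

lemma common_refinement:
  assumes p: "(n, s) \<in> partitions a b" and q: "(m, r) \<in> partitions a b"
  obtains N u where "(N, u) \<in> partitions a b" "s ` {..n} \<subseteq> u ` {..N}" "r ` {..m} \<subseteq> u ` {..N}"
proof -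
  have "s 0 = a" "s n = b" using p by (auto simp: partitions_def)
  then have "a \<in> s ` {..n} \<union> r ` {..m}" "b \<in> s ` {..n} \<union> r ` {..m}" by blast+
  moreover have "s ` {..n} \<union> r ` {..m} \<subseteq> {a..b}"
    using partition_bounds[OF p] partition_bounds[OF q] by auto
  ultimately obtain N u where "(N, u) \<in> partitions a b" "u ` {..N} = s ` {..n} \<union> r ` {..m}"
    using partition_of_finite_set[of "s ` {..n} \<union> r ` {..m}" a b] by auto
  then show thesis using that by blast
qed

lemma mesh_ge:
  assumes "j < n"
  shows "s (Suc j) - s j \<le> mesh (n, s)"
proof -
  have "s (Suc j) - s (Suc j - 1) \<le> mesh (n, s)"
    unfolding mesh_def prod.case by (rule Max_ge) (use assms in \<open>auto intro!: image_eqI[of _ _ "Suc j"]\<close>)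
  then show ?thesis by simp
qed

lemma uniform_modulus:
  fixes g :: "real \<Rightarrow> real"
  assumes "continuous_on {a..b} g" "e > 0"
  obtains d where "d > 0" "\<forall>x\<in>{a..b}. \<forall>y\<in>{a..b}. \<bar>x - y\<bar> < d \<longrightarrow> \<bar>g x - g y\<bar> < e"
  using compact_uniformly_continuous[OF assms(1) compact_Icc] assms(2)
  unfolding uniformly_continuous_on_def dist_real_def by metis

lemma continuous_bound:
  fixes g :: "real \<Rightarrow> real"
  assumes "continuous_on {a..b} g"
  obtains C where "C \<ge> 0" "\<And>x. x \<in> {a..b} \<Longrightarrow> \<bar>g x\<bar> \<le> C"
proof -
  have "bounded (g ` {a..b})" by (intro compact_imp_bounded compact_continuous_image assms) simp
  then obtain C where "\<And>x. x \<in> {a..b} \<Longrightarrow> \<bar>g x\<bar> \<le> C" unfolding bounded_real by blast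
  then show thesis using that[of "max 0 C"] by fastforce
qed

text \<open>Mesh limits are studied along sequences of partitions, on which almost sure convergence can be used.\<close>

locale partition_sequence =
  fixes a b :: real and n :: "nat \<Rightarrow> nat" and s :: "nat \<Rightarrow> nat \<Rightarrow> real"
  assumes partition: "\<And>k. (n k, s k) \<in> partitions a b"
    and mesh_lim: "(\<lambda>k. mesh (n k, s k)) \<longlonglongrightarrow> 0"
begin

lemma eventually_cell_modulus:
  fixes g :: "real \<Rightarrow> real"
  assumes g: "continuous_on {a..b} g" and e: "e > 0"
  shows "\<forall>\<^sub>F k in sequentially. \<forall>j<n k. \<forall>x\<in>{s k j..s k (Suc j)}. \<forall>y\<in>{s k j..s k (Suc j)}. \<bar>g x - g y\<bar> < e"
proof -
  obtain d where d: "d > 0" "\<forall>x\<in>{a..b}. \<forall>y\<in>{a..b}. \<bar>x - y\<bar> < d \<longrightarrow> \<bar>g x - g y\<bar> < e"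
    by (rule uniform_modulus[OF g e])
  have "\<forall>\<^sub>F k in sequentially. mesh (n k, s k) < d" using order_tendstoD(2)[OF mesh_lim d(1)] .
  then show ?thesis
  proof eventually_elim
    case (elim k)
    show ?case
    proof (intro allI impI ballI)
      fix j x y assume j: "j < n k" and xy: "x \<in> {s k j..s k (Suc j)}" "y \<in> {s k j..s k (Suc j)}"
      have "\<bar>x - y\<bar> < d" using mesh_ge[OF j, of "s k"] elim xy by auto
      moreover have "x \<in> {a..b}" "y \<in> {a..b}"
        using partition_bounds[OF partition[of k], of j] partition_bounds[OF partition[of k], of "Suc j"] j xy by auto
      ultimately show "\<bar>g x - g y\<bar> < e" using d(2) by blast
    qed
  qed
qed

lemma left_step_tendsto:
  fixes g :: "real \<Rightarrow> real"
  assumes g: "continuous_on {a..b} g" and t: "t \<in> {a<..b}"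
  shows "(\<lambda>k. step_fun (n k) (s k) (\<lambda>j. g (s k j)) t) \<longlonglongrightarrow> g t"
proof (rule tendstoI)
  fix e :: real assume "e > 0"
  from eventually_cell_modulus[OF g this]
  show "\<forall>\<^sub>F k in sequentially. dist (step_fun (n k) (s k) (\<lambda>j. g (s k j)) t) (g t) < e"
  proof eventually_elim
    case (elim k)
    obtain j where j: "j < n k" "t \<in> {s k j<..s k (Suc j)}" by (rule partition_cell_exists[OF partition t])
    then show ?case using elim step_fun_cell[OF partition j] by (auto simp: dist_real_def)
  qed
qed

lemma left_step_bound:
  fixes g :: "real \<Rightarrow> real"
  assumes g: "\<And>x. x \<in> {a..b} \<Longrightarrow> \<bar>g x\<bar> \<le> C" and t: "t \<in> {a<..b}"
  shows "\<bar>step_fun (n k) (s k) (\<lambda>j. g (s k j)) t\<bar> \<le> C"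
proof -
  obtain j where j: "j < n k" "t \<in> {s k j<..s k (Suc j)}" by (rule partition_cell_exists[OF partition t])
  then show ?thesis using step_fun_cell[OF partition j] g partition_bounds[OF partition[of k], of j] by auto
qed

end

text \<open>The hypotheses leave out the null set consisting of \<open>a\<close>, because a step function is 0 there whatever it
  approximates.\<close>

lemma set_integral_tendsto_bounded:
  fixes f :: "nat \<Rightarrow> real \<Rightarrow> real"
  assumes f: "\<And>k. set_borel_measurable lborel {a..b} (f k)" and g: "set_borel_measurable lborel {a..b} g"
    and lim: "\<And>t. t \<in> {a<..b} \<Longrightarrow> (\<lambda>k. f k t) \<longlonglongrightarrow> g t"
    and bd: "\<And>k t. t \<in> {a<..b} \<Longrightarrow> \<bar>f k t\<bar> \<le> C"
  shows "(\<lambda>k. LBINT t:{a..b}. f k t) \<longlonglongrightarrow> (LBINT t:{a..b}. g t)"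
  unfolding set_lebesgue_integral_def
proof (rule integral_dominated_convergence[where w = "\<lambda>t. C * indicator {a..b} t"])
  have ne: "AE t in lborel. t \<noteq> a" by (rule AE_lborel_singleton)
  show "AE t in lborel. (\<lambda>k. indicat_real {a..b} t *\<^sub>R f k t) \<longlonglongrightarrow> indicat_real {a..b} t *\<^sub>R g t"
    using ne by eventually_elim (auto simp: indicator_def lim)
  show "AE t in lborel. norm (indicat_real {a..b} t *\<^sub>R f k t) \<le> C * indicator {a..b} t" for k
    using ne by eventually_elim (auto simp: indicator_def bd)
  show "integrable lborel (\<lambda>t. C * indicator {a..b} t)"
    by (intro integrable_mult_right integrable_real_indicator) (auto simp: emeasure_lborel_Icc_eq)
qed (use f g in \<open>auto simp: set_borel_measurable_def\<close>)

lemma continuous_on_set_borel_measurable: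
  fixes g :: "real \<Rightarrow> real"
  assumes "continuous_on {a..b} g"
  shows "set_borel_measurable lborel {a..b} g"
  using borel_measurable_continuous_on_indicator[OF _ assms] by (simp add: set_borel_measurable_def)

lemma (in partition_sequence) riemann_sum_tendsto:
  assumes g: "continuous_on {a..b} g"
  shows "(\<lambda>k. \<Sum>j<n k. g (s k j) * (s k (Suc j) - s k j)) \<longlonglongrightarrow> (LBINT t:{a..b}. g t)"
proof -
  obtain C where C: "\<And>x. x \<in> {a..b} \<Longrightarrow> \<bar>g x\<bar> \<le> C" using continuous_bound[OF g] by blast
  have "(\<lambda>k. LBINT t:{a..b}. step_fun (n k) (s k) (\<lambda>j. g (s k j)) t) \<longlonglongrightarrow> (LBINT t:{a..b}. g t)"
    by (rule set_integral_tendsto_bounded[OF _ continuous_on_set_borel_measurable[OF g] left_step_tendsto[OF g] left_step_bound[OF C]])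
       (auto simp: set_borel_measurable_def)
  then show ?thesis unfolding step_fun_integral(2)[OF partition] .
qed

lemma uniform_partition_sequence:
  assumes "a < b"
  shows "partition_sequence a b Suc (\<lambda>k j. a + real j * ((b - a) / real (Suc k)))"
proof
  fix k
  let ?s = "\<lambda>j. a + real j * ((b - a) / real (Suc k))"
  have h: "(b - a) / real (Suc k) > 0" using assms by simp
  have "?s j < ?s (Suc j)" for j
    by (intro add_strict_left_mono mult_strict_right_mono h) simp
  moreover have "?s (Suc k) = b" by simp
  ultimately show "(Suc k, ?s) \<in> partitions a b" by (simp add: partitions_def)
next
  have "mesh (Suc k, \<lambda>j. a + real j * ((b - a) / real (Suc k))) = (b - a) / real (Suc k)" for k
  proof -
    have "(\<lambda>j. (a + real j * ((b - a) / real (Suc k))) - (a + real (j - 1) * ((b - a) / real (Suc k)))) ` {1..Suc k}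
      = (\<lambda>j. (b - a) / real (Suc k)) ` {1..Suc k}"
    proof (rule image_cong[OF refl])
      fix j assume j: "j \<in> {1..Suc k}"
      have "(a + real j * h) - (a + real (j - 1) * h) = h" for h
        using j by (simp add: of_nat_diff left_diff_distrib)
      then show "(a + real j * ((b - a) / real (Suc k))) - (a + real (j - 1) * ((b - a) / real (Suc k))) = (b - a) / real (Suc k)" .
    qed
    then show ?thesis unfolding mesh_def prod.case by simp
  qed
  moreover have "(\<lambda>k. (b - a) / real (Suc k)) \<longlonglongrightarrow> 0"
    by (rule LIMSEQ_Suc[OF lim_const_over_n])
  ultimately show "(\<lambda>k. mesh (Suc k, \<lambda>j. a + real j * ((b - a) / real (Suc k)))) \<longlonglongrightarrow> 0" by simp
qed

lemma step_fun_diff_sq_integrable: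
  assumes p: "(n, s) \<in> partitions a b"
    and x: "set_borel_measurable lborel {a..b} x" "set_integrable lborel {a..b} (\<lambda>t. (x t)\<^sup>2)"
  shows "set_integrable lborel {a..b} (\<lambda>t. (step_fun n s c t - x t)\<^sup>2)"
proof (rule set_integrable_bound)
  show "set_integrable lborel {a..b} (\<lambda>t. 2 * (step_fun n s c t)\<^sup>2 + 2 * (x t)\<^sup>2)"
    unfolding step_fun_map[OF p, of "\<lambda>x. x\<^sup>2", simplified]
    by (intro set_integral_add set_integrable_mult_right step_fun_integral(1)[OF p] x(2)) 
  have "(\<lambda>t. indicator {a..b} t *\<^sub>R (step_fun n s c t - x t)\<^sup>2) =
    (\<lambda>t. (indicator {a..b} t *\<^sub>R step_fun n s c t - indicator {a..b} t *\<^sub>R x t)\<^sup>2)"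
    by (auto simp: indicator_def)
  moreover have "\<dots> \<in> borel_measurable lborel"
    using x(1) unfolding set_borel_measurable_def
    by (intro borel_measurable_power borel_measurable_diff) auto
  ultimately show "set_borel_measurable lborel {a..b} (\<lambda>t. (step_fun n s c t - x t)\<^sup>2)"
    unfolding set_borel_measurable_def by simp
  have "(y - z)\<^sup>2 \<le> 2 * y\<^sup>2 + 2 * z\<^sup>2" for y z :: real
    using zero_le_power2[of "y + z"] by (simp add: power2_sum power2_diff)
  then show "AE t in lborel. t \<in> {a..b} \<longrightarrow> norm ((step_fun n s c t - x t)\<^sup>2) \<le> norm (2 * (step_fun n s c t)\<^sup>2 + 2 * (x t)\<^sup>2)"
    by auto
qed

text \<open>The inequality \<open>(y - z)\<^sup>2 \<le> 2 (y - w)\<^sup>2 + 2 (z - w)\<^sup>2\<close> integrated. The integrability of all three squares has to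
  be checked, since the integral of a non-integrable function is 0 by convention.\<close>

lemma step_fun_diff_sq_integral_le:
  assumes p: "(n, s) \<in> partitions a b" and q: "(m, r) \<in> partitions a b"
    and x: "set_borel_measurable lborel {a..b} x" "set_integrable lborel {a..b} (\<lambda>t. (x t)\<^sup>2)"
  shows "(LBINT t:{a..b}. (step_fun n s c t - step_fun m r d t)\<^sup>2)
    \<le> 2 * (LBINT t:{a..b}. (step_fun n s c t - x t)\<^sup>2) + 2 * (LBINT t:{a..b}. (step_fun m r d t - x t)\<^sup>2)"
proof -
  note i1 = step_fun_diff_sq_integrable[OF p x, of c] and i2 = step_fun_diff_sq_integrable[OF q x, of d]
  have "set_borel_measurable lborel {a..b} (step_fun m r d)"
    unfolding set_borel_measurable_def by measurable
  moreover have "set_integrable lborel {a..b} (\<lambda>t. (step_fun m r d t)\<^sup>2)"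
    unfolding step_fun_map[OF q, of "\<lambda>x. x\<^sup>2", simplified] by (rule step_fun_integral(1)[OF q])
  ultimately have i3: "set_integrable lborel {a..b} (\<lambda>t. (step_fun n s c t - step_fun m r d t)\<^sup>2)"
    by (rule step_fun_diff_sq_integrable[OF p])
  have "(y - z)\<^sup>2 \<le> 2 * (y - w)\<^sup>2 + 2 * (z - w)\<^sup>2" for y z w :: real
    using zero_le_power2[of "(y - w) + (z - w)"] by (simp add: power2_eq_square algebra_simps)
  then have "(LBINT t:{a..b}. (step_fun n s c t - step_fun m r d t)\<^sup>2)
    \<le> (LBINT t:{a..b}. 2 * (step_fun n s c t - x t)\<^sup>2 + 2 * (step_fun m r d t - x t)\<^sup>2)"
    by (intro set_integral_mono i3 set_integral_add set_integrable_mult_right i1 i2) auto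
  also have "\<dots> = 2 * (LBINT t:{a..b}. (step_fun n s c t - x t)\<^sup>2) + 2 * (LBINT t:{a..b}. (step_fun m r d t - x t)\<^sup>2)"
    by (simp only: set_integral_add(2)[OF set_integrable_mult_right set_integrable_mult_right] set_integral_mult_right i1 i2)
  finally show ?thesis .
qed

section \<open>The past of Brownian motion and its increments\<close>

context brownian_motion
begin

abbreviation "\<F> \<equiv> natural_filtration M W"

lemma natural_filtration_basics:
  "space (\<F> t) = space M" "sets (\<F> t) \<subseteq> events"
  "sets (\<F> t) = sigma_sets (space M) {W s -` A \<inter> space M | s A. 0 \<le> s \<and> s \<le> t \<and> A \<in> sets borel}"
proof -
  let ?G = "{W s -` A \<inter> space M | s A. 0 \<le> s \<and> s \<le> t \<and> A \<in> sets borel}"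
  have sub: "?G \<subseteq> events" using measurable_sets[OF random_variable_W] by auto
  then have "?G \<subseteq> Pow (space M)" using sets.sets_into_space by blast
  then show "space (\<F> t) = space M" and eq: "sets (\<F> t) = sigma_sets (space M) ?G"
    by (simp_all add: natural_filtration_def)
  show "sets (\<F> t) \<subseteq> events" unfolding eq using sub by (rule sets.sigma_sets_subset)
qed

lemma W_adapted: "0 \<le> s \<Longrightarrow> s \<le> t \<Longrightarrow> W s \<in> borel_measurable (\<F> t)"
  by (rule measurableI) (auto simp: natural_filtration_basics intro!: sigma_sets.Basic)

lemma natural_filtration_mono:
  fixes X :: "'a \<Rightarrow> real"
  assumes st: "s \<le> t" and X: "X \<in> borel_measurable (\<F> s)"
  shows "X \<in> borel_measurable (\<F> t)"
proof (rule measurableI)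
  fix A :: "real set" assume A: "A \<in> sets borel"
  have "X -` A \<inter> space (\<F> s) \<in> sets (\<F> s)" using X A by (rule measurable_sets)
  moreover have "sets (\<F> s) \<subseteq> sets (\<F> t)"
    unfolding natural_filtration_basics by (rule sigma_sets_mono') (use st in force)
  ultimately show "X -` A \<inter> space (\<F> t) \<in> sets (\<F> t)" by (auto simp: natural_filtration_basics)
qed auto

lemma natural_filtration_measurable: "X \<in> borel_measurable (\<F> t) \<Longrightarrow> X \<in> borel_measurable M"
  using natural_filtration_basics(1,2)[of t] by (auto simp: measurable_def)

text \<open>A cylinder event up to time \<open>s\<close> depends only on the increments along a partition of \<open>[0,s]\<close>, up to the null set
  where \<open>W 0\<close> differs from 0, and these are independent of the next increment, from \<open>s\<close> to \<open>t\<close>.\<close>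

lemma increment_indep_cylinder:
  assumes s: "0 \<le> s" "s < t" and U: "finite U" "U \<subseteq> {0..s}" and B: "\<And>u. B u \<in> sets borel" and C: "C \<in> sets borel"
  shows "prob ({\<omega> \<in> space M. \<forall>u\<in>U. W u \<omega> \<in> B u} \<inter> ((\<lambda>\<omega>. W t \<omega> - W s \<omega>) -` C \<inter> space M)) =
    prob {\<omega> \<in> space M. \<forall>u\<in>U. W u \<omega> \<in> B u} * prob ((\<lambda>\<omega>. W t \<omega> - W s \<omega>) -` C \<inter> space M)"
proof -
  obtain n r where r: "(n, r) \<in> partitions 0 s" "r ` {..n} = insert 0 (insert s U)"
    by (rule partition_of_finite_set[of "insert 0 (insert s U)" 0 s]) (use s U in auto)
  \<comment> \<open>the time \<open>t\<close> is appended, so that the last of the increments runs from \<open>s\<close> to \<open>t\<close>\<close>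
  define q where "q = r(Suc n := t)"
  define D where "D j \<omega> = W (q (Suc j)) \<omega> - W (q j) \<omega>" for j \<omega>
  have ind: "indep_vars (\<lambda>_. borel) D {..<Suc n}"
    unfolding D_def using r(1) s by (intro indep_increments) (auto simp: q_def partitions_def less_Suc_eq)
  have Dn: "D n = (\<lambda>\<omega>. W t \<omega> - W s \<omega>)" using r(1) by (simp add: D_def q_def partitions_def fun_eq_iff)
  have "\<forall>u\<in>U. \<exists>i\<le>n. q i = u"
  proof
    fix u assume "u \<in> U"
    then obtain i where "i \<le> n" "r i = u" using r(2) by (metis atMost_iff imageE insertCI)
    then show "\<exists>i\<le>n. q i = u" by (intro exI[of _ i]) (auto simp: q_def)
  qed
  then obtain idx where idx: "\<And>u. u \<in> U \<Longrightarrow> idx u \<le> n" "\<And>u. u \<in> U \<Longrightarrow> q (idx u) = u" by metis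
  have W_eq: "W u \<omega> = (\<Sum>l<idx u. D l \<omega>)" if "u \<in> U" "W 0 \<omega> = 0" for u \<omega>
  proof -
    have "q 0 = 0" using r(1) by (simp add: q_def partitions_def)
    then show ?thesis unfolding D_def sum_lessThan_telescope[where f="\<lambda>i. W (q i) \<omega>"] using idx(2)[OF that(1)] that(2) by simp
  qed
  define G where "G = {x \<in> space (PiM {..<n} (\<lambda>_. borel :: real measure)). \<forall>u\<in>U. (\<Sum>l<idx u. x l) \<in> B u}"
  have G[measurable]: "G \<in> sets (PiM {..<n} (\<lambda>_. borel :: real measure))"
    unfolding G_def
  proof (rule sets.sets_Collect_finite_All[OF _ U(1)])
    fix u assume u: "u \<in> U"
    have f: "(\<lambda>x. \<Sum>l<idx u. x l) \<in> PiM {..<n} (\<lambda>_. borel :: real measure) \<rightarrow>\<^sub>M borel"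
      using idx(1)[OF u] by (intro borel_measurable_sum measurable_component_singleton) auto
    show "{x \<in> space (PiM {..<n} (\<lambda>_. borel :: real measure)). (\<Sum>l<idx u. x l) \<in> B u}
      \<in> sets (PiM {..<n} (\<lambda>_. borel :: real measure))"
      using measurable_sets[OF f B[of u]] by (simp only: vimage_def Int_def mem_Collect_eq conj_commute)
  qed
  let ?X = "\<lambda>\<omega>. restrict (\<lambda>i. D i \<omega>) {..<n}" and ?Y = "\<lambda>\<omega>. restrict (\<lambda>i. D i \<omega>) {n}"
  have XY: "indep_var (PiM {..<n} (\<lambda>_. borel :: real measure)) ?X (PiM {n} (\<lambda>_. borel :: real measure)) ?Y"
    by (rule indep_var_restrict[OF ind]) auto
  define C' where "C' = (\<lambda>x. x n) -` C \<inter> space (PiM {n} (\<lambda>_. borel :: real measure))"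
  have C': "C' \<in> sets (PiM {n} (\<lambda>_. borel :: real measure))"
    unfolding C'_def using C by (intro measurable_sets[OF measurable_component_singleton]) auto
  have "?Y -` C' \<inter> space M = D n -` C \<inter> space M" by (auto simp: C'_def space_PiM)
  then have eq: "prob ((?X -` G \<inter> space M) \<inter> (D n -` C \<inter> space M)) = prob (?X -` G \<inter> space M) * prob (D n -` C \<inter> space M)"
    using XY G C' unfolding indep_var_eq indep_sets2_eq by (metis (mono_tags, lifting) mem_Collect_eq sigma_sets.Basic)
  have [measurable]: "?X \<in> M \<rightarrow>\<^sub>M PiM {..<n} (\<lambda>_. borel)"
    using XY by (auto simp: indep_var_eq)
  have [measurable]: "D n \<in> borel_measurable M"
    unfolding Dn using s by (intro borel_measurable_diff random_variable_W) auto
  have XG: "?X -` G \<inter> space M \<in> events" by (rule measurable_sets) measurable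
  have DC: "D n -` C \<inter> space M \<in> events" by (rule measurable_sets) (use C in measurable)
  have cyl: "{\<omega> \<in> space M. \<forall>u\<in>U. W u \<omega> \<in> B u} \<in> events"
  proof (rule sets.sets_Collect_finite_All[OF _ U(1)])
    fix u assume "u \<in> U"
    then have [measurable]: "W u \<in> borel_measurable M" using U by (intro random_variable_W) auto
    show "{\<omega> \<in> space M. W u \<omega> \<in> B u} \<in> events" using B[of u] by measurable
  qed
  have ae: "AE \<omega> in M. (\<omega> \<in> {\<omega> \<in> space M. \<forall>u\<in>U. W u \<omega> \<in> B u}) = (\<omega> \<in> ?X -` G \<inter> space M)"
    using start_zero
  proof eventually_elim
    case (elim \<omega>)
    have "(\<Sum>l<idx u. ?X \<omega> l) = W u \<omega>" if "u \<in> U" for u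
      unfolding W_eq[OF that elim] using idx(1)[OF that] by (intro sum.cong) auto
    then show ?case by (auto simp: G_def space_PiM)
  qed
  have e1: "prob {\<omega> \<in> space M. \<forall>u\<in>U. W u \<omega> \<in> B u} = prob (?X -` G \<inter> space M)"
    using ae by (intro finite_measure_eq_AE) (auto intro: cyl XG)
  have e2: "prob ({\<omega> \<in> space M. \<forall>u\<in>U. W u \<omega> \<in> B u} \<inter> (D n -` C \<inter> space M)) = prob ((?X -` G \<inter> space M) \<inter> (D n -` C \<inter> space M))"
  proof (intro finite_measure_eq_AE)
    show "AE \<omega> in M. (\<omega> \<in> {\<omega> \<in> space M. \<forall>u\<in>U. W u \<omega> \<in> B u} \<inter> (D n -` C \<inter> space M)) =
      (\<omega> \<in> (?X -` G \<inter> space M) \<inter> (D n -` C \<inter> space M))"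
      using ae by eventually_elim auto
  qed (use cyl XG DC in auto)
  show ?thesis using eq e1 e2 unfolding Dn by simp
qed

text \<open>The finite-dimensional cylinders form a generator of the past that is stable under intersection, so
  independence passes from them to the generated sigma-algebra.\<close>

lemma increment_indep:
  assumes s: "0 \<le> s" "s < t" and X: "X \<in> borel_measurable (\<F> s)"
  shows "indep_var borel X borel (\<lambda>\<omega>. W t \<omega> - W s \<omega>)"
proof -
  define D where "D \<omega> = W t \<omega> - W s \<omega>" for \<omega>
  have [measurable]: "W t \<in> borel_measurable M" "W s \<in> borel_measurable M"
    using s by (auto intro!: random_variable_W)
  have D[measurable]: "D \<in> borel_measurable M" unfolding D_def by measurable
  define \<A> where "\<A> = {{\<omega> \<in> space M. \<forall>u\<in>U. W u \<omega> \<in> B u} | U B. finite U \<and> U \<subseteq> {0..s} \<and> (\<forall>u. B u \<in> sets borel)}"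
  define \<B> where "\<B> = {D -` C \<inter> space M | C. C \<in> sets borel}"
  have cyl: "{\<omega> \<in> space M. \<forall>u\<in>U. W u \<omega> \<in> B u} \<in> events" if "finite U" "U \<subseteq> {0..s}" "\<And>u. B u \<in> sets borel" for U B
  proof (rule sets.sets_Collect_finite_All[OF _ that(1)])
    fix u assume "u \<in> U"
    then have [measurable]: "W u \<in> borel_measurable M" using that(2) by (intro random_variable_W) auto
    show "{\<omega> \<in> space M. W u \<omega> \<in> B u} \<in> events" using that(3)[of u] by measurable
  qed
  have "indep_set \<A> \<B>"
    unfolding indep_sets2_eq
  proof (intro conjI ballI)
    show "\<A> \<subseteq> events" unfolding \<A>_def using cyl by blast
    show "\<B> \<subseteq> events" unfolding \<B>_def using measurable_sets[OF D] by blast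
    fix P Q assume "P \<in> \<A>" "Q \<in> \<B>"
    then show "prob (P \<inter> Q) = prob P * prob Q"
      unfolding \<A>_def \<B>_def D_def using increment_indep_cylinder[OF s] by auto
  qed
  moreover have "Int_stable \<A>"
  proof (rule Int_stableI)
    fix P Q assume "P \<in> \<A>" "Q \<in> \<A>"
    then obtain U B V C where P: "P = {\<omega> \<in> space M. \<forall>u\<in>U. W u \<omega> \<in> B u}" "finite U" "U \<subseteq> {0..s}" "\<forall>u. B u \<in> sets borel"
      and Q: "Q = {\<omega> \<in> space M. \<forall>u\<in>V. W u \<omega> \<in> C u}" "finite V" "V \<subseteq> {0..s}" "\<forall>u. C u \<in> sets borel"
      unfolding \<A>_def by blast
    \<comment> \<open>the constraints of both cylinders, with none at times outside \<open>U\<close> or \<open>V\<close>\<close>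
    define E where "E u = (if u \<in> U then B u else UNIV) \<inter> (if u \<in> V then C u else UNIV)" for u
    have "P \<inter> Q = {\<omega> \<in> space M. \<forall>u\<in>U\<union>V. W u \<omega> \<in> E u}"
      unfolding P(1) Q(1) E_def by auto
    moreover have "finite (U \<union> V)" "U \<union> V \<subseteq> {0..s}" "\<forall>u. E u \<in> sets borel"
      using P Q by (auto simp: E_def)
    ultimately show "P \<inter> Q \<in> \<A>" unfolding \<A>_def by blast
  qed
  moreover have "Int_stable \<B>"
  proof (rule Int_stableI)
    fix P Q assume "P \<in> \<B>" "Q \<in> \<B>"
    then obtain B C where "P = D -` B \<inter> space M" "B \<in> sets borel" "Q = D -` C \<inter> space M" "C \<in> sets borel"
      unfolding \<B>_def by blast
    then have "P \<inter> Q = D -` (B \<inter> C) \<inter> space M" "B \<inter> C \<in> sets borel" by auto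
    then show "P \<inter> Q \<in> \<B>" unfolding \<B>_def by blast
  qed
  ultimately have ind: "indep_set (sigma_sets (space M) \<A>) (sigma_sets (space M) \<B>)"
    by (rule indep_set_sigma_sets)
  have sF: "sets (\<F> s) \<subseteq> sigma_sets (space M) \<A>"
    unfolding natural_filtration_basics
  proof (rule sigma_sets_mono, rule subsetI)
    fix P assume "P \<in> {W u -` A \<inter> space M | u A. 0 \<le> u \<and> u \<le> s \<and> A \<in> sets borel}"
    then obtain u A where u: "P = W u -` A \<inter> space M" "0 \<le> u" "u \<le> s" "A \<in> sets borel" by blast
    then have "P = {\<omega> \<in> space M. \<forall>v\<in>{u}. W v \<omega> \<in> (\<lambda>_. A) v}" by auto
    then have "P \<in> \<A>" unfolding \<A>_def mem_Collect_eq
      by (intro exI[of _ "{u}"] exI[of _ "\<lambda>_. A"] conjI) (use u in auto)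
    then show "P \<in> sigma_sets (space M) \<A>" by (rule sigma_sets.Basic)
  qed
  have "sigma_sets (space M) {X -` A \<inter> space M | A. A \<in> sets borel} \<subseteq> sigma_sets (space M) \<A>"
  proof (rule sigma_sets_mono, rule subsetI)
    fix P assume "P \<in> {X -` A \<inter> space M | A. A \<in> sets borel}"
    then obtain A where "P = X -` A \<inter> space M" "A \<in> sets borel" by blast
    then have "P \<in> sets (\<F> s)" using measurable_sets[OF X] by (simp add: natural_filtration_basics(1))
    then show "P \<in> sigma_sets (space M) \<A>" using sF by blast
  qed
  then have "indep_set (sigma_sets (space M) {X -` A \<inter> space M | A. A \<in> sets borel}) (sigma_sets (space M) \<B>)"
    using ind unfolding indep_sets2_eq by blast
  then have "indep_var borel X borel D"
    unfolding indep_var_eq \<B>_def using natural_filtration_measurable[OF X] D by simp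
  then show ?thesis unfolding D_def .
qed

lemma increment_moments:
  assumes s: "0 \<le> s" "s < t"
  shows "integrable M (\<lambda>\<omega>. (W t \<omega> - W s \<omega>) ^ k)"
    and "expectation (\<lambda>\<omega>. W t \<omega> - W s \<omega>) = 0"
    and "expectation (\<lambda>\<omega>. (W t \<omega> - W s \<omega>)\<^sup>2) = t - s"
    and "expectation (\<lambda>\<omega>. (W t \<omega> - W s \<omega>) ^ 4) = 3 * (t - s)\<^sup>2"
proof -
  define \<sigma> where "\<sigma> = sqrt (t - s)"
  have \<sigma>: "\<sigma> > 0" "\<sigma>\<^sup>2 = t - s" using s by (simp_all add: \<sigma>_def)
  note D = normal_increments[OF s, folded \<sigma>_def]
  have E: "expectation (\<lambda>\<omega>. (W t \<omega> - W s \<omega>) ^ k) = (\<integral>x. normal_density 0 \<sigma> x * x ^ k \<partial>lborel)" for k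
    by (subst distributed_integral[OF D, of "\<lambda>x. x ^ k", symmetric]) auto
  show "integrable M (\<lambda>\<omega>. (W t \<omega> - W s \<omega>) ^ k)" for k
    using distributed_integrable[OF D, of "\<lambda>x. x ^ k"] integrable_normal_moment[OF \<sigma>(1), of 0 k] by simp
  show "expectation (\<lambda>\<omega>. W t \<omega> - W s \<omega>) = 0"
    using E[of 1] integral_normal_moment_odd[OF \<sigma>(1), of 0 0] by simp
  show "expectation (\<lambda>\<omega>. (W t \<omega> - W s \<omega>)\<^sup>2) = t - s"
    using E[of 2] integral_normal_moment_even[OF \<sigma>(1), of 0 1] \<sigma>
    unfolding mult_1_right diff_0_right power_one_right by (simp add: fact_numeral)
  have "expectation (\<lambda>\<omega>. (W t \<omega> - W s \<omega>) ^ 4) = fact 4 / ((2 / \<sigma>\<^sup>2)\<^sup>2 * fact 2)"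
    using E[of 4] integral_normal_moment_even[OF \<sigma>(1), of 0 2] by simp
  also have "\<dots> = 3 * (t - s)\<^sup>2" using \<sigma> by (simp add: fact_numeral power_divide)
  finally show "expectation (\<lambda>\<omega>. (W t \<omega> - W s \<omega>) ^ 4) = 3 * (t - s)\<^sup>2" .
qed

text \<open>The variance \<open>2 (v - u)\<^sup>2\<close> comes from the Gaussian fourth moment \<open>3 (v - u)\<^sup>2\<close>.\<close>

lemma centred_square_moments:
  assumes u: "0 \<le> u" "u < v"
  shows "integrable M (\<lambda>\<omega>. ((W v \<omega> - W u \<omega>)\<^sup>2 - (v - u))\<^sup>2)"
    and "expectation (\<lambda>\<omega>. (W v \<omega> - W u \<omega>)\<^sup>2 - (v - u)) = 0"
    and "expectation (\<lambda>\<omega>. ((W v \<omega> - W u \<omega>)\<^sup>2 - (v - u))\<^sup>2) = 2 * (v - u)\<^sup>2"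
proof -
  note m = increment_moments[OF u]
  have eq: "((W v \<omega> - W u \<omega>)\<^sup>2 - (v - u))\<^sup>2 =
    (W v \<omega> - W u \<omega>)^4 - (2 * (v - u)) * (W v \<omega> - W u \<omega>)\<^sup>2 + (v - u)\<^sup>2" for \<omega>
  proof -
    have "(x\<^sup>2 - \<tau>)\<^sup>2 = x^4 - (2 * \<tau>) * x\<^sup>2 + \<tau>\<^sup>2" for x \<tau> :: real
      by (simp add: power2_eq_square power4_eq_xxxx algebra_simps)
    then show ?thesis .
  qed
  show "integrable M (\<lambda>\<omega>. ((W v \<omega> - W u \<omega>)\<^sup>2 - (v - u))\<^sup>2)"
    unfolding eq using m(1)[of 4] m(1)[of 2] by simp
  show "expectation (\<lambda>\<omega>. (W v \<omega> - W u \<omega>)\<^sup>2 - (v - u)) = 0"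
    using m(1)[of 2] m(3) by (simp add: prob_space)
  have "expectation (\<lambda>\<omega>. ((W v \<omega> - W u \<omega>)\<^sup>2 - (v - u))\<^sup>2)
    = expectation (\<lambda>\<omega>. (W v \<omega> - W u \<omega>)^4) - (2 * (v - u)) * expectation (\<lambda>\<omega>. (W v \<omega> - W u \<omega>)\<^sup>2) + (v - u)\<^sup>2"
    unfolding eq using m(1)[of 4] m(1)[of 2] by (simp add: prob_space)
  also have "\<dots> = 2 * (v - u)\<^sup>2" unfolding m(3,4) by (simp add: power2_eq_square algebra_simps)
  finally show "expectation (\<lambda>\<omega>. ((W v \<omega> - W u \<omega>)\<^sup>2 - (v - u))\<^sup>2) = 2 * (v - u)\<^sup>2" .
qed

end

section \<open>The Ito integral of a process with continuous paths\<close>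

text \<open>The squared distance of a step process to a process with irregular paths on a null set need not be
  measurable for \<open>M\<close>, but it agrees almost everywhere with a measurable function.\<close>

lemma completion_measurable_AE_eq:
  fixes f g :: "'a \<Rightarrow> real"
  assumes f: "f \<in> borel_measurable M" and eq: "AE x in M. f x = g x"
  shows "g \<in> borel_measurable (completion M)"
proof (rule measurableI)
  fix A :: "real set" assume A: "A \<in> sets borel"
  show "g -` A \<inter> space (completion M) \<in> sets (completion M)"
  proof (rule completion.in_sets_AE)
    show "f -` A \<inter> space M \<in> sets (completion M)" using measurable_sets[OF f A] by simp
    show "AE x in completion M. (x \<in> f -` A \<inter> space M) = (x \<in> g -` A \<inter> space (completion M))"
      by (rule AE_completion) (use eq in \<open>eventually_elim, auto\<close>)
  qed auto
qed auto

definition sq_dist :: "real \<Rightarrow> real \<Rightarrow> (real \<Rightarrow> 'a \<Rightarrow> real) \<Rightarrow> 'a simple_process \<Rightarrow> 'a \<Rightarrow> real" where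
  "sq_dist a b X f \<omega> = (LBINT t:{a..b}. (simple_eval f t \<omega> - X t \<omega>)\<^sup>2)"

context brownian_motion
begin

text \<open>Simple processes without the bound on the coefficients: left-point sums of \<open>\<Phi> \<circ> W\<close> are integrals of such processes.\<close>

definition adapted_steps :: "real \<Rightarrow> real \<Rightarrow> 'a simple_process set" where
  "adapted_steps a b = {(n, s, \<xi>). (n, s) \<in> partitions a b \<and> (\<forall>j<n. \<xi> j \<in> borel_measurable (\<F> (s j)))}"

lemma simple_process_adapted: "f \<in> simple_processes M \<F> a b \<Longrightarrow> f \<in> adapted_steps a b"
  by (auto simp: simple_processes_def adapted_steps_def)

lemma adapted_step_refine:
  assumes f: "(n, s, \<xi>) \<in> adapted_steps a b" and q: "(N, u) \<in> partitions a b" and sub: "s ` {..n} \<subseteq> u ` {..N}"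
    and i: "i < N"
  shows "simple_eval (n, s, \<xi>) (u (Suc i)) \<in> borel_measurable (\<F> (u i))"
proof -
  have p: "(n, s) \<in> partitions a b" using f by (simp add: adapted_steps_def)
  obtain j where j: "j < n" "s j \<le> u i" "u (Suc i) \<le> s (Suc j)" by (rule refinement_cell[OF p q sub i])
  have "simple_eval (n, s, \<xi>) (u (Suc i)) = \<xi> j"
  proof
    fix \<omega>
    show "simple_eval (n, s, \<xi>) (u (Suc i)) \<omega> = \<xi> j \<omega>"
      unfolding simple_eval_step_fun
      by (rule step_fun_cell[OF p j(1)]) (use j partition_less[OF q, of i "Suc i"] i in auto)
  qed
  moreover have "\<xi> j \<in> borel_measurable (\<F> (s j))" using f j(1) by (simp add: adapted_steps_def)
  ultimately show ?thesis by (simp only: natural_filtration_mono[OF j(2)])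
qed

text \<open>Differences of step processes are formed on a common refinement; the coefficients there are known at
  the left end points.\<close>

lemma adapted_step_diff:
  assumes f: "f \<in> adapted_steps a b" and g: "g \<in> adapted_steps a b"
  obtains h where "h \<in> adapted_steps a b"
    "\<And>t \<omega>. simple_eval h t \<omega> = simple_eval f t \<omega> - simple_eval g t \<omega>"
    "\<And>\<omega>. simple_integral_wrt W h \<omega> = simple_integral_wrt W f \<omega> - simple_integral_wrt W g \<omega>"
proof -
  obtain n s \<xi> where f_eq: "f = (n, s, \<xi>)" by (cases f)
  obtain m r \<eta> where g_eq: "g = (m, r, \<eta>)" by (cases g)
  have p: "(n, s) \<in> partitions a b" and q: "(m, r) \<in> partitions a b"
    using f g by (auto simp: f_eq g_eq adapted_steps_def)
  obtain N u where u: "(N, u) \<in> partitions a b" "s ` {..n} \<subseteq> u ` {..N}" "r ` {..m} \<subseteq> u ` {..N}"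
    by (rule common_refinement[OF p q])
  define \<zeta> where "\<zeta> i \<omega> = simple_eval f (u (Suc i)) \<omega> - simple_eval g (u (Suc i)) \<omega>" for i \<omega>
  show thesis
  proof (rule that[of "(N, u, \<zeta>)"])
    have "\<zeta> i \<in> borel_measurable (\<F> (u i))" if "i < N" for i
      unfolding \<zeta>_def
      using adapted_step_refine[OF f[unfolded f_eq] u(1,2) that] adapted_step_refine[OF g[unfolded g_eq] u(1,3) that]
      by (intro borel_measurable_diff) (simp_all add: f_eq g_eq)
    then show "(N, u, \<zeta>) \<in> adapted_steps a b" using u(1) by (simp add: adapted_steps_def)
    fix \<omega>
    show "simple_eval (N, u, \<zeta>) t \<omega> = simple_eval f t \<omega> - simple_eval g t \<omega>" for t
      unfolding f_eq g_eq simple_eval_step_fun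
        step_fun_refine[OF p u(1,2), of _ t] step_fun_refine[OF q u(1,3), of _ t]
      by (simp add: \<zeta>_def f_eq g_eq simple_eval_step_fun step_fun_def left_diff_distrib sum_subtractf)
    show "simple_integral_wrt W (N, u, \<zeta>) \<omega> = simple_integral_wrt W f \<omega> - simple_integral_wrt W g \<omega>"
      unfolding f_eq g_eq simple_integral_wrt_def prod.case
        step_sum_refine[OF p u(1,2), of "\<lambda>j. \<xi> j \<omega>" "\<lambda>t. W t \<omega>"] step_sum_refine[OF q u(1,3), of "\<lambda>j. \<eta> j \<omega>" "\<lambda>t. W t \<omega>"]
      by (simp add: \<zeta>_def f_eq g_eq simple_eval_step_fun left_diff_distrib sum_subtractf)
  qed
qed

lemma adapted_step_measurable:
  assumes f: "(n, s, \<xi>) \<in> adapted_steps a b" and j: "j < n"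
  shows "\<xi> j \<in> borel_measurable M"
  using f j by (auto simp: adapted_steps_def intro: natural_filtration_measurable)

lemma simple_integral_measurable:
  assumes a: "0 \<le> a" and f: "f \<in> adapted_steps a b"
  shows "simple_integral_wrt W f \<in> borel_measurable M"
proof -
  obtain n s \<xi> where f_eq: "f = (n, s, \<xi>)" by (cases f)
  have p: "(n, s) \<in> partitions a b" using f by (simp add: f_eq adapted_steps_def)
  have "0 \<le> s j" if "j \<le> n" for j using partition_bounds[OF p that] a by simp
  then show ?thesis unfolding f_eq simple_integral_wrt_def prod.case
    by (intro borel_measurable_sum borel_measurable_times borel_measurable_diff random_variable_W
        adapted_step_measurable[OF f[unfolded f_eq]]) auto
qed

lemma adapted_step_sq_integral:
  assumes f: "(n, s, \<xi>) \<in> adapted_steps a b"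
  shows "(LBINT t:{a..b}. (simple_eval (n, s, \<xi>) t \<omega>)\<^sup>2) = (\<Sum>j<n. (\<xi> j \<omega>)\<^sup>2 * (s (Suc j) - s j))"
proof -
  have p: "(n, s) \<in> partitions a b" using f by (simp add: adapted_steps_def)
  show ?thesis
    unfolding simple_eval_step_fun step_fun_map[OF p, of "\<lambda>x. x\<^sup>2", simplified] step_fun_integral(2)[OF p] ..
qed

lemma adapted_step_sq_measurable:
  assumes f: "f \<in> adapted_steps a b"
  shows "(\<lambda>\<omega>. LBINT t:{a..b}. (simple_eval f t \<omega>)\<^sup>2) \<in> borel_measurable M"
proof -
  obtain n s \<xi> where f_eq: "f = (n, s, \<xi>)" by (cases f)
  show ?thesis unfolding f_eq adapted_step_sq_integral[OF f[unfolded f_eq]]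
    by (intro borel_measurable_sum borel_measurable_times borel_measurable_power
        adapted_step_measurable[OF f[unfolded f_eq]]) auto
qed

text \<open>For a step process the sum \<open>\<Sum> \<xi>\<^sub>j\<^sup>2 v\<^sub>j\<close> of the tail bound is the integral of its square.\<close>

lemma adapted_step_tail_bound:
  assumes a: "0 \<le> a" and f: "f \<in> adapted_steps a b" and pos: "\<delta> > 0" "\<epsilon> > 0"
  shows "prob {\<omega> \<in> space M. \<bar>simple_integral_wrt W f \<omega>\<bar> > \<epsilon>}
    \<le> prob {\<omega> \<in> space M. (LBINT t:{a..b}. (simple_eval f t \<omega>)\<^sup>2) > \<delta>} + \<delta> / \<epsilon>\<^sup>2"
proof -
  obtain n s \<xi> where f_eq: "f = (n, s, \<xi>)" by (cases f)
  have p: "(n, s) \<in> partitions a b" and xi: "\<And>j. j < n \<Longrightarrow> \<xi> j \<in> borel_measurable (\<F> (s j))"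
    using f by (auto simp: f_eq adapted_steps_def)
  have s0: "0 \<le> s j" if "j \<le> n" for j using partition_bounds[OF p that] a by simp
  show ?thesis
    unfolding f_eq adapted_step_sq_integral[OF f[unfolded f_eq]] simple_integral_wrt_def prod.case
  proof (rule martingale_transform_tail_bound[of n "\<lambda>j. \<F> (s j)"])
    fix j assume j: "j < n"
    have lt: "0 \<le> s j" "s j < s (Suc j)" using s0[of j] partition_less[OF p, of j "Suc j"] j by auto
    show "sets (\<F> (s j)) \<subseteq> events \<and> space (\<F> (s j)) = space M" by (simp add: natural_filtration_basics(1,2))
    show "(\<lambda>\<omega>. W (s (Suc j)) \<omega> - W (s j) \<omega>) \<in> borel_measurable M"
      using s0[of j] s0[of "Suc j"] j by (intro borel_measurable_diff random_variable_W) auto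
    show "indep_var borel X borel (\<lambda>\<omega>. W (s (Suc j)) \<omega> - W (s j) \<omega>)" if "X \<in> borel_measurable (\<F> (s j))" for X
      by (rule increment_indep[OF lt that])
    show "integrable M (\<lambda>\<omega>. (W (s (Suc j)) \<omega> - W (s j) \<omega>)\<^sup>2)" by (rule increment_moments(1)[OF lt])
    show "expectation (\<lambda>\<omega>. W (s (Suc j)) \<omega> - W (s j) \<omega>) = 0" by (rule increment_moments(2)[OF lt])
    show "expectation (\<lambda>\<omega>. (W (s (Suc j)) \<omega> - W (s j) \<omega>)\<^sup>2) = s (Suc j) - s j" by (rule increment_moments(3)[OF lt])
    show "0 < s (Suc j) - s j" using lt by simp
    fix i
    show "\<xi> i \<in> borel_measurable (\<F> (s j))" if "i \<le> j"
      by (rule natural_filtration_mono[OF _ xi]) (use partition_mono[OF p that] j that in auto)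
    show "(\<lambda>\<omega>. W (s (Suc i)) \<omega> - W (s i) \<omega>) \<in> borel_measurable (\<F> (s j))" if "i < j"
      using s0[of i] s0[of "Suc i"] partition_mono[OF p, of "Suc i" j] partition_mono[OF p, of i j] j that
      by (intro borel_measurable_diff W_adapted) auto
  qed (use pos in auto)
qed

lemma tendsto_in_prob_completionD:
  assumes Y: "\<And>k. Y k \<in> borel_measurable M" and lim: "tendsto_in_prob (completion M) Y (\<lambda>_. 0) F"
  shows "tendsto_in_prob M Y (\<lambda>_. 0) F"
proof (rule tendsto_in_probI)
  fix \<epsilon> :: real assume "\<epsilon> > 0"
  have "{\<omega> \<in> space M. \<bar>Y i \<omega>\<bar> > \<epsilon>} \<in> events" for i using Y[of i] by measurable
  then have eq: "measure (completion M) {\<omega> \<in> space M. \<bar>Y i \<omega>\<bar> > \<epsilon>} = prob {\<omega> \<in> space M. \<bar>Y i \<omega>\<bar> > \<epsilon>}" for i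
    by (rule measure_completion)
  have "((\<lambda>i. measure (completion M) {\<omega> \<in> space M. \<bar>Y i \<omega>\<bar> > \<epsilon>}) \<longlongrightarrow> 0) F"
    using lim \<open>\<epsilon> > 0\<close> unfolding tendsto_in_prob_def by simp
  then show "((\<lambda>i. prob {\<omega> \<in> space M. \<bar>Y i \<omega> - 0\<bar> > \<epsilon>}) \<longlongrightarrow> 0) F"
    unfolding eq by simp
qed (use Y in auto)

text \<open>The integral of the squared difference of \<open>f k\<close> and \<open>g k\<close> is bounded by the two squared distances to \<open>X\<close>, so it tends to 0 in
  probability, and the tail bound for the difference process applies.\<close>

lemma approximations_have_close_integrals:
  assumes a: "0 \<le> a"
    and X: "AE \<omega> in M. set_borel_measurable lborel {a..b} (\<lambda>t. X t \<omega>) \<and> set_integrable lborel {a..b} (\<lambda>t. (X t \<omega>)\<^sup>2)"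
    and f: "\<And>k. f k \<in> adapted_steps a b" and g: "\<And>k. g k \<in> adapted_steps a b"
    and fX: "tendsto_in_prob (completion M) (\<lambda>k. sq_dist a b X (f k)) (\<lambda>_. 0) sequentially"
    and gX: "tendsto_in_prob (completion M) (\<lambda>k. sq_dist a b X (g k)) (\<lambda>_. 0) sequentially"
  shows "tendsto_in_prob M (\<lambda>k \<omega>. simple_integral_wrt W (f k) \<omega> - simple_integral_wrt W (g k) \<omega>) (\<lambda>_. 0) sequentially"
proof -
  interpret C: prob_space "completion M" by (rule prob_space_completion)
  have "\<exists>h. h \<in> adapted_steps a b \<and> (\<forall>t \<omega>. simple_eval h t \<omega> = simple_eval (f k) t \<omega> - simple_eval (g k) t \<omega>) \<and>
    (\<forall>\<omega>. simple_integral_wrt W h \<omega> = simple_integral_wrt W (f k) \<omega> - simple_integral_wrt W (g k) \<omega>)" for k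
    using adapted_step_diff[OF f g] by metis
  then obtain h where h: "\<And>k. h k \<in> adapted_steps a b"
    "\<And>k t \<omega>. simple_eval (h k) t \<omega> = simple_eval (f k) t \<omega> - simple_eval (g k) t \<omega>"
    "\<And>k \<omega>. simple_integral_wrt W (h k) \<omega> = simple_integral_wrt W (f k) \<omega> - simple_integral_wrt W (g k) \<omega>"
    by metis
  define Q where "Q k \<omega> = (LBINT t:{a..b}. (simple_eval (h k) t \<omega>)\<^sup>2)" for k \<omega>
  have Qm: "Q k \<in> borel_measurable M" for k unfolding Q_def by (rule adapted_step_sq_measurable[OF h(1)])
  have Q0: "0 \<le> Q k \<omega>" for k \<omega>
    unfolding Q_def set_lebesgue_integral_def by (rule Bochner_Integration.integral_nonneg) (auto simp: indicator_def)
  have Q_le: "AE \<omega> in completion M. \<bar>Q k \<omega>\<bar> \<le> 2 * sq_dist a b X (f k) \<omega> + 2 * sq_dist a b X (g k) \<omega>" for k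
  proof -
    obtain n s \<xi> where f_eq: "f k = (n, s, \<xi>)" by (cases "f k")
    obtain m r \<eta> where g_eq: "g k = (m, r, \<eta>)" by (cases "g k")
    have p: "(n, s) \<in> partitions a b" and q: "(m, r) \<in> partitions a b"
      using f[of k] g[of k] by (auto simp: f_eq g_eq adapted_steps_def)
    have "AE \<omega> in M. \<bar>Q k \<omega>\<bar> \<le> 2 * sq_dist a b X (f k) \<omega> + 2 * sq_dist a b X (g k) \<omega>"
      using X
    proof eventually_elim
      case (elim \<omega>)
      then show ?case
        unfolding abs_of_nonneg[OF Q0] unfolding Q_def h(2) f_eq g_eq sq_dist_def simple_eval_step_fun
        by (intro step_fun_diff_sq_integral_le p q) auto
    qed
    then show ?thesis by (rule AE_completion)
  qed
  have "tendsto_in_prob (completion M) Q (\<lambda>_. 0) sequentially"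
  proof (rule C.tendsto_in_prob_0_dominated[OF _ measurable_completion[OF Qm] Q_le])
    show "tendsto_in_prob (completion M) (\<lambda>k \<omega>. 2 * sq_dist a b X (f k) \<omega> + 2 * sq_dist a b X (g k) \<omega>) (\<lambda>_. 0) sequentially"
      using C.tendsto_in_prob_add[OF C.tendsto_in_prob_cmult[OF fX, of 2] C.tendsto_in_prob_cmult[OF gX, of 2]] by simp
  qed
  then have Q: "tendsto_in_prob M Q (\<lambda>_. 0) sequentially" by (rule tendsto_in_prob_completionD[OF Qm])
  have "tendsto_in_prob M (\<lambda>k. simple_integral_wrt W (h k)) (\<lambda>_. 0) sequentially"
  proof (rule tendsto_in_prob_0_if_bound[OF Q simple_integral_measurable[OF a h(1)]])
    fix k and \<epsilon> \<delta> :: real assume "\<epsilon> > 0" "\<delta> > 0"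
    then show "prob {\<omega> \<in> space M. \<bar>simple_integral_wrt W (h k) \<omega>\<bar> > \<epsilon>}
      \<le> prob {\<omega> \<in> space M. \<bar>Q k \<omega>\<bar> > \<delta>} + \<delta> / \<epsilon>\<^sup>2"
      using adapted_step_tail_bound[OF a h(1)] unfolding abs_of_nonneg[OF Q0] unfolding Q_def by blast
  qed
  then show ?thesis by (simp add: h(3)[abs_def])
qed

end

locale adapted_continuous_process = brownian_motion M W
  for M :: "'a measure" and W :: "real \<Rightarrow> 'a \<Rightarrow> real" +
  fixes a b :: real and X :: "real \<Rightarrow> 'a \<Rightarrow> real"
  assumes a_nonneg: "0 \<le> a" and a_less_b: "a < b"
    and adapted: "\<And>t. t \<in> {a..b} \<Longrightarrow> X t \<in> borel_measurable (natural_filtration M W t)"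
    and continuous: "AE \<omega> in M. continuous_on {a..b} (\<lambda>t. X t \<omega>)"
begin

definition left_step :: "(real \<Rightarrow> real) \<Rightarrow> partition \<Rightarrow> 'a simple_process" where
  "left_step \<phi> = (\<lambda>(n, s). (n, s, \<lambda>j \<omega>. \<phi> (X (s j) \<omega>)))"

lemma left_step_adapted:
  assumes "(n, s) \<in> partitions a b" and [measurable]: "\<phi> \<in> borel_measurable borel"
  shows "left_step \<phi> (n, s) \<in> adapted_steps a b"
proof -
  have "(\<lambda>\<omega>. \<phi> (X (s j) \<omega>)) \<in> borel_measurable (\<F> (s j))" if "j < n" for j
    using adapted[of "s j"] partition_bounds[OF assms(1), of j] that
    by (intro measurable_compose[OF _ assms(2)]) auto
  then show ?thesis using assms(1) by (simp add: left_step_def adapted_steps_def)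
qed

lemma path_sq_integrable:
  "AE \<omega> in M. set_borel_measurable lborel {a..b} (\<lambda>t. X t \<omega>) \<and> set_integrable lborel {a..b} (\<lambda>t. (X t \<omega>)\<^sup>2)"
  using continuous
proof eventually_elim
  case (elim \<omega>)
  then show ?case
    by (intro conjI continuous_on_set_borel_measurable borel_integrable_atLeastAtMost' continuous_on_power)
qed

text \<open>The left-point step processes of \<open>X\<close> along the uniform partitions converge to \<open>X\<close> on every continuous path. Hence the
  distance to \<open>X\<close> is almost surely a limit of distances between step processes, which are finite sums of
  measurable functions.\<close>

lemma sq_dist_measurable:
  assumes f: "f \<in> adapted_steps a b"
  shows "sq_dist a b X f \<in> borel_measurable (completion M)"
proof -
  interpret D: partition_sequence a b Suc "\<lambda>k j. a + real j * ((b - a) / real (Suc k))"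
    by (rule uniform_partition_sequence[OF a_less_b])
  define s where "s = (\<lambda>k j. a + real j * ((b - a) / real (Suc k)))"
  obtain n r \<xi> where f_eq: "f = (n, r, \<xi>)" by (cases f)
  have p: "(n, r) \<in> partitions a b" using f by (simp add: f_eq adapted_steps_def)
  define Q where "Q k \<omega> = (LBINT t:{a..b}. (simple_eval f t \<omega> - simple_eval (left_step (\<lambda>x. x) (Suc k, s k)) t \<omega>)\<^sup>2)" for k \<omega>
  have Q: "Q k \<in> borel_measurable M" for k
  proof -
    have "left_step (\<lambda>x. x) (Suc k, s k) \<in> adapted_steps a b"
      unfolding s_def by (intro left_step_adapted D.partition) auto
    then obtain h where h: "h \<in> adapted_steps a b"
      "\<And>t \<omega>. simple_eval h t \<omega> = simple_eval f t \<omega> - simple_eval (left_step (\<lambda>x. x) (Suc k, s k)) t \<omega>"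
      using adapted_step_diff[OF f] by metis
    show ?thesis using adapted_step_sq_measurable[OF h(1)] unfolding Q_def h(2)[symmetric] .
  qed
  have "AE \<omega> in M. lim (\<lambda>k. Q k \<omega>) = sq_dist a b X f \<omega>"
    using continuous
  proof eventually_elim
    case (elim \<omega>)
    obtain C where C: "C \<ge> 0" "\<And>t. t \<in> {a..b} \<Longrightarrow> \<bar>X t \<omega>\<bar> \<le> C" using continuous_bound[OF elim] by blast
    define B where "B = (\<Sum>j<n. \<bar>\<xi> j \<omega>\<bar>)"
    have B: "\<bar>step_fun n r (\<lambda>j. \<xi> j \<omega>) t\<bar> \<le> B" for t
      unfolding step_fun_def B_def
      by (rule order_trans[OF sum_abs sum_mono]) (auto simp: indicator_def)
    let ?x = "\<lambda>t. X t \<omega>" and ?c = "\<lambda>j. \<xi> j \<omega>"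
    let ?L = "\<lambda>k t. step_fun (Suc k) (s k) (\<lambda>j. ?x (s k j)) t"
    have "(\<lambda>k. LBINT t:{a..b}. (step_fun n r ?c t - ?L k t)\<^sup>2) \<longlonglongrightarrow> (LBINT t:{a..b}. (step_fun n r ?c t - ?x t)\<^sup>2)"
    proof (rule set_integral_tendsto_bounded)
      show "set_borel_measurable lborel {a..b} (\<lambda>t. (step_fun n r ?c t - ?L k t)\<^sup>2)" for k
        unfolding set_borel_measurable_def by measurable
      show "set_borel_measurable lborel {a..b} (\<lambda>t. (step_fun n r ?c t - ?x t)\<^sup>2)"
        using step_fun_diff_sq_integrable[OF p continuous_on_set_borel_measurable[OF elim]
            borel_integrable_atLeastAtMost'[OF continuous_on_power[OF elim]]]
        by (auto simp: set_borel_measurable_def set_integrable_def dest: borel_measurable_integrable)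
      fix t assume t: "t \<in> {a<..b}"
      show "(\<lambda>k. (step_fun n r ?c t - ?L k t)\<^sup>2) \<longlonglongrightarrow> (step_fun n r ?c t - ?x t)\<^sup>2"
        using D.left_step_tendsto[OF elim t] unfolding s_def by (intro tendsto_intros)
      fix k
      have "\<bar>?L k t\<bar> \<le> C" unfolding s_def
        by (rule D.left_step_bound[where g = "\<lambda>t. X t \<omega>", OF C(2) t])
      then have "\<bar>step_fun n r ?c t - ?L k t\<bar> \<le> B + C" using B[of t] by linarith
      then show "\<bar>(step_fun n r ?c t - ?L k t)\<^sup>2\<bar> \<le> (B + C)\<^sup>2"
        using abs_le_square_iff[of "step_fun n r ?c t - ?L k t" "B + C"] by simp
    qed
    then have "(\<lambda>k. Q k \<omega>) \<longlonglongrightarrow> sq_dist a b X f \<omega>"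
      by (simp add: Q_def sq_dist_def f_eq left_step_def simple_eval_step_fun)
    then show ?case by (rule limI)
  qed
  moreover have "(\<lambda>\<omega>. lim (\<lambda>k. Q k \<omega>)) \<in> borel_measurable M" using Q by measurable
  ultimately show ?thesis by (rule completion_measurable_AE_eq[rotated])
qed

text \<open>The functions \<open>\<phi> k\<close> allow both the identity and clipping at height \<open>k\<close>: a continuous path is bounded on
  \<open>[a,b]\<close>, so it is eventually unaffected by the clipping.\<close>

lemma left_step_approximates:
  assumes "partition_sequence a b n s"
    and \<phi>[measurable]: "\<And>k. \<phi> k \<in> borel_measurable borel" and le: "\<And>k x. \<bar>\<phi> k x\<bar> \<le> \<bar>x\<bar>"
    and lim: "\<And>C. \<forall>\<^sub>F k in sequentially. \<forall>x. \<bar>x\<bar> \<le> C \<longrightarrow> \<phi> k x = x"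
  shows "tendsto_in_prob (completion M) (\<lambda>k. sq_dist a b X (left_step (\<phi> k) (n k, s k))) (\<lambda>_. 0) sequentially"
proof -
  interpret D: partition_sequence a b n s by fact
  interpret C: prob_space "completion M" by (rule prob_space_completion)
  show ?thesis
  proof (rule C.tendsto_in_prob_if_AE)
    show "sq_dist a b X (left_step (\<phi> k) (n k, s k)) \<in> borel_measurable (completion M)" for k
      by (intro sq_dist_measurable left_step_adapted D.partition \<phi>)
    have "AE \<omega> in M. (\<lambda>k. sq_dist a b X (left_step (\<phi> k) (n k, s k)) \<omega>) \<longlonglongrightarrow> 0"
      using continuous
    proof eventually_elim
      case (elim \<omega>)
      let ?x = "\<lambda>t. X t \<omega>"
      obtain C where C: "C \<ge> 0" "\<And>t. t \<in> {a..b} \<Longrightarrow> \<bar>X t \<omega>\<bar> \<le> C" using continuous_bound[OF elim] by blast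
      let ?L = "\<lambda>k t. step_fun (n k) (s k) (\<lambda>j. \<phi> k (?x (s k j))) t"
      have "(\<lambda>k. LBINT t:{a..b}. (?L k t - ?x t)\<^sup>2) \<longlonglongrightarrow> (LBINT t:{a..b}. 0)"
      proof (rule set_integral_tendsto_bounded)
        show "set_borel_measurable lborel {a..b} (\<lambda>t. (?L k t - ?x t)\<^sup>2)" for k
          using step_fun_diff_sq_integrable[OF D.partition continuous_on_set_borel_measurable[OF elim]
            borel_integrable_atLeastAtMost'[OF continuous_on_power[OF elim]]]
          by (auto simp: set_borel_measurable_def set_integrable_def dest: borel_measurable_integrable)
        fix t assume t: "t \<in> {a<..b}"
        have "\<forall>\<^sub>F k in sequentially. step_fun (n k) (s k) (\<lambda>j. ?x (s k j)) t = ?L k t"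
          using lim[of C]
        proof eventually_elim
          case (elim k)
          show ?case unfolding step_fun_def
          proof (rule sum.cong[OF refl])
            fix j assume "j \<in> {..<n k}"
            then have "\<bar>?x (s k j)\<bar> \<le> C" using partition_bounds[OF D.partition[of k], of j] by (intro C) auto
            then show "?x (s k j) * indicator {s k j<..s k (Suc j)} t = \<phi> k (?x (s k j)) * indicator {s k j<..s k (Suc j)} t"
              using elim by simp
          qed
        qed
        then have "(\<lambda>k. ?L k t) \<longlonglongrightarrow> ?x t"
          using D.left_step_tendsto[OF elim t] by (rule Lim_transform_eventually[rotated])
        then have "(\<lambda>k. (?L k t - ?x t)\<^sup>2) \<longlonglongrightarrow> (?x t - ?x t)\<^sup>2" by (intro tendsto_intros)
        then show "(\<lambda>k. (?L k t - ?x t)\<^sup>2) \<longlonglongrightarrow> 0" by simp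
        fix k
        obtain j where j: "j < n k" "t \<in> {s k j<..s k (Suc j)}" by (rule partition_cell_exists[OF D.partition t])
        have "\<bar>?x (s k j)\<bar> \<le> C" using partition_bounds[OF D.partition[of k], of j] j by (intro C) auto
        then have "\<bar>?L k t\<bar> \<le> C" unfolding step_fun_cell[OF D.partition j] using le order_trans by blast
        moreover have "\<bar>?x t\<bar> \<le> C" using C t by auto
        ultimately have "\<bar>?L k t - ?x t\<bar> \<le> C + C" by linarith
        then show "\<bar>(?L k t - ?x t)\<^sup>2\<bar> \<le> (C + C)\<^sup>2"
          using abs_le_square_iff[of "?L k t - ?x t" "C + C"] by simp
      qed (simp add: set_borel_measurable_def)
      then show ?case by (simp add: sq_dist_def left_step_def simple_eval_step_fun)
    qed
    then show "AE \<omega> in completion M. (\<lambda>k. sq_dist a b X (left_step (\<phi> k) (n k, s k)) \<omega>) \<longlonglongrightarrow> 0"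
      by (rule AE_completion)
  qed simp
qed

text \<open>Clipping turns the left-point step processes into simple processes with bounded coefficients, as the
  definition of the integral demands.\<close>

lemma ito_integral_exists: "\<exists>I. has_ito_integral M W a b X I"
proof -
  interpret D: partition_sequence a b Suc "\<lambda>k j. a + real j * ((b - a) / real (Suc k))"
    by (rule uniform_partition_sequence[OF a_less_b])
  interpret C: prob_space "completion M" by (rule prob_space_completion)
  define s where "s = (\<lambda>k j. a + real j * ((b - a) / real (Suc k)))"
  have part: "(Suc k, s k) \<in> partitions a b" for k using D.partition[of k] unfolding s_def .
  define clip where "clip k x = max (- real k) (min (real k) x)" for k :: nat and x :: real
  have clip[measurable]: "clip k \<in> borel_measurable borel" for k unfolding clip_def by measurable
  define f where "f k = left_step (clip k) (Suc k, s k)" for k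
  have f_adapted: "f k \<in> adapted_steps a b" for k unfolding f_def by (rule left_step_adapted[OF part clip])
  have f_simple: "f k \<in> simple_processes M \<F> a b" for k
  proof -
    have "\<bar>clip k x\<bar> \<le> real k" for x unfolding clip_def by auto
    then show ?thesis
      using f_adapted[of k] by (auto simp: f_def left_step_def adapted_steps_def simple_processes_def)
  qed
  have approx: "tendsto_in_prob (completion M) (\<lambda>k. sq_dist a b X (f k)) (\<lambda>_. 0) sequentially"
    unfolding f_def s_def
  proof (rule left_step_approximates[OF D.partition_sequence_axioms clip])
    show "\<bar>clip k x\<bar> \<le> \<bar>x\<bar>" for k x unfolding clip_def by auto
    fix C :: real
    have "\<forall>\<^sub>F k in sequentially. C \<le> real k"
      by (rule eventually_at_top_linorderI[of "nat \<lceil>C\<rceil>"]) linarith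
    then show "\<forall>\<^sub>F k in sequentially. \<forall>x. \<bar>x\<bar> \<le> C \<longrightarrow> clip k x = x"
      by eventually_elim (auto simp: clip_def)
  qed
  have "\<exists>I. tendsto_in_prob M (\<lambda>k. simple_integral_wrt W (f k)) I sequentially"
  proof (rule tendsto_in_prob_if_Cauchy[OF simple_integral_measurable[OF a_nonneg f_adapted]])
    fix p q :: "nat \<Rightarrow> nat" assume pq: "filterlim p at_top sequentially" "filterlim q at_top sequentially"
    have sub: "tendsto_in_prob (completion M) (\<lambda>k. sq_dist a b X (f (r k))) (\<lambda>_. 0) sequentially"
      if "filterlim r at_top sequentially" for r
    proof (rule C.tendsto_in_probI)
      show "((\<lambda>i. C.prob {\<omega> \<in> space (completion M). \<epsilon> < \<bar>sq_dist a b X (f (r i)) \<omega> - 0\<bar>}) \<longlonglongrightarrow> 0)" if "\<epsilon> > 0" for \<epsilon>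
        by (rule filterlim_compose[OF C.tendsto_in_probD(3)[OF approx that] \<open>filterlim r at_top sequentially\<close>])
    qed (auto intro: sq_dist_measurable f_adapted)
    show "tendsto_in_prob M (\<lambda>k \<omega>. simple_integral_wrt W (f (p k)) \<omega> - simple_integral_wrt W (f (q k)) \<omega>) (\<lambda>_. 0) sequentially"
      by (rule approximations_have_close_integrals[OF a_nonneg path_sq_integrable f_adapted f_adapted sub[OF pq(1)] sub[OF pq(2)]])
  qed
  then obtain I where "tendsto_in_prob M (\<lambda>k. simple_integral_wrt W (f k)) I sequentially" by blast
  then have "has_ito_integral M W a b X I"
    unfolding has_ito_integral_def using adapted path_sq_integrable f_simple approx
    unfolding sq_dist_def[abs_def] by blast
  then show ?thesis by (rule exI[of _ I])
qed

text \<open>Any approximating sequence that witnesses the integral is compared with the left-point step processes, so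
  the limit does not depend on the choice of the sequence.\<close>

lemma left_sums_tendsto_ito_integral:
  assumes I: "has_ito_integral M W a b X I" and "partition_sequence a b n s"
  shows "tendsto_in_prob M (\<lambda>k \<omega>. \<Sum>j<n k. X (s k j) \<omega> * (W (s k (Suc j)) \<omega> - W (s k j) \<omega>)) I sequentially"
proof -
  interpret D: partition_sequence a b n s by fact
  obtain f where f: "\<And>k. f k \<in> simple_processes M \<F> a b"
    "tendsto_in_prob (completion M) (\<lambda>k. sq_dist a b X (f k)) (\<lambda>_. 0) sequentially"
    "tendsto_in_prob M (\<lambda>k. simple_integral_wrt W (f k)) I sequentially"
    using I unfolding has_ito_integral_def sq_dist_def[abs_def] by blast
  let ?g = "\<lambda>k. left_step (\<lambda>x. x) (n k, s k)"
  have "tendsto_in_prob M (\<lambda>k \<omega>. simple_integral_wrt W (?g k) \<omega> - simple_integral_wrt W (f k) \<omega>) (\<lambda>_. 0) sequentially"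
    by (rule approximations_have_close_integrals[OF a_nonneg path_sq_integrable _ simple_process_adapted[OF f(1)] _ f(2)])
       (auto intro!: left_step_adapted D.partition left_step_approximates[OF assms(2)])
  from tendsto_in_prob_add[OF this f(3)] show ?thesis
    by (simp add: left_step_def simple_integral_wrt_def)
qed

end

section \<open>Limits along the mesh filter\<close>

lemma eventually_mesh_to_0:
  "eventually P (mesh_to_0 a b) \<longleftrightarrow> (\<exists>\<delta>>0. \<forall>\<Delta>\<in>partitions a b. mesh \<Delta> < \<delta> \<longrightarrow> P \<Delta>)"
proof -
  have "eventually P (mesh_to_0 a b) \<longleftrightarrow> (\<exists>\<delta>\<in>{0<..}. eventually P (principal {\<Delta> \<in> partitions a b. mesh \<Delta> < \<delta>}))"
    unfolding mesh_to_0_def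
  proof (rule eventually_INF_base)
    fix \<delta> \<epsilon> :: real assume "\<delta> \<in> {0<..}" "\<epsilon> \<in> {0<..}"
    then show "\<exists>x\<in>{0<..}. principal {\<Delta> \<in> partitions a b. mesh \<Delta> < x}
      \<le> inf (principal {\<Delta> \<in> partitions a b. mesh \<Delta> < \<delta>}) (principal {\<Delta> \<in> partitions a b. mesh \<Delta> < \<epsilon>})"
      by (intro bexI[of _ "min \<delta> \<epsilon>"]) auto
  qed auto
  then show ?thesis by (auto simp: eventually_principal)
qed

lemma mesh_to_0_nontrivial:
  assumes "a < b"
  shows "mesh_to_0 a b \<noteq> bot"
proof
  assume "mesh_to_0 a b = bot"
  then have "eventually (\<lambda>_. False) (mesh_to_0 a b)" by simp
  then obtain \<delta> where \<delta>: "\<delta> > 0" "\<And>\<Delta>. \<Delta> \<in> partitions a b \<Longrightarrow> \<not> mesh \<Delta> < \<delta>"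
    unfolding eventually_mesh_to_0 by blast
  interpret D: partition_sequence a b Suc "\<lambda>k j. a + real j * ((b - a) / real (Suc k))"
    by (rule uniform_partition_sequence[OF assms])
  from order_tendstoD(2)[OF D.mesh_lim \<delta>(1)] show False
    using \<delta>(2)[OF D.partition] by simp
qed

text \<open>The mesh filter has the countable base of the sets of partitions with mesh below \<open>1 / Suc k\<close>; if the limit failed,
  one bad partition from each of them would form a bad sequence.\<close>

lemma tendsto_mesh_to_0_if_sequences:
  fixes g :: "partition \<Rightarrow> real"
  assumes "a < b" and "\<And>n s. partition_sequence a b n s \<Longrightarrow> (\<lambda>k. g (n k, s k)) \<longlonglongrightarrow> L"
  shows "(g \<longlongrightarrow> L) (mesh_to_0 a b)"
proof (rule tendstoI)
  fix e :: real assume e: "e > 0"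
  show "\<forall>\<^sub>F \<Delta> in mesh_to_0 a b. dist (g \<Delta>) L < e"
  proof (rule ccontr)
    assume "\<not> ?thesis"
    then have "\<forall>\<delta>>0. \<exists>\<Delta>\<in>partitions a b. mesh \<Delta> < \<delta> \<and> \<not> dist (g \<Delta>) L < e"
      unfolding eventually_mesh_to_0 by blast
    then have "\<forall>k. \<exists>\<Delta>. \<Delta> \<in> partitions a b \<and> mesh \<Delta> < 1 / real (Suc k) \<and> \<not> dist (g \<Delta>) L < e"
      by (metis of_nat_0_less_iff zero_less_Suc zero_less_divide_1_iff)
    then obtain D where D: "\<And>k. D k \<in> partitions a b" "\<And>k. mesh (D k) < 1 / real (Suc k)" "\<And>k. \<not> dist (g (D k)) L < e"
      by metis
    \<comment> \<open>needs a cell, as the maximum of the empty set is unspecified; \<open>a < b\<close> provides one\<close>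
    have nonneg: "0 \<le> mesh (D k)" for k
    proof (cases "D k")
      case (Pair n s)
      show ?thesis
      proof (cases "n = 0")
        case True
        then show ?thesis using D(1)[of k] assms(1) by (simp add: Pair partitions_def)
      next
        case False
        have "0 \<le> s (Suc 0) - s 0"
          using partition_mono[of n s a b 0 "Suc 0"] D(1)[of k] False by (simp add: Pair)
        also have "\<dots> \<le> mesh (n, s)" using False by (intro mesh_ge) simp
        finally show ?thesis by (simp add: Pair)
      qed
    qed
    have "partition_sequence a b (\<lambda>k. fst (D k)) (\<lambda>k. snd (D k))"
    proof
      show "(\<lambda>k. mesh (fst (D k), snd (D k))) \<longlonglongrightarrow> 0"
      proof (rule tendsto_sandwich[OF _ _ tendsto_const LIMSEQ_Suc[OF lim_1_over_n]])
        show "\<forall>\<^sub>F k in sequentially. mesh (fst (D k), snd (D k)) \<le> 1 / real (Suc k)"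
          by (rule always_eventually, rule allI) (simp only: prod.collapse less_imp_le[OF D(2)])
      qed (simp add: nonneg)
    qed (simp add: D(1))
    from tendstoD[OF assms(2)[OF this] e] show False using D(3) by simp
  qed
qed

lemma (in prob_space) tendsto_in_prob_mesh_to_0_if_sequences:
  assumes "a < b" and Y: "\<And>\<Delta>. \<Delta> \<in> partitions a b \<Longrightarrow> Y \<Delta> \<in> borel_measurable M" and L: "L \<in> borel_measurable M"
    and lim: "\<And>n s. partition_sequence a b n s \<Longrightarrow> tendsto_in_prob M (\<lambda>k. Y (n k, s k)) L sequentially"
  shows "tendsto_in_prob M Y L (mesh_to_0 a b)"
  unfolding tendsto_in_prob_def
proof (intro conjI allI impI)
  show "\<forall>\<^sub>F \<Delta> in mesh_to_0 a b. Y \<Delta> \<in> borel_measurable M"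
    unfolding eventually_mesh_to_0 by (intro exI[of _ 1]) (use Y in auto)
  show "((\<lambda>\<Delta>. prob {\<omega> \<in> space M. \<bar>Y \<Delta> \<omega> - L \<omega>\<bar> > \<epsilon>}) \<longlongrightarrow> 0) (mesh_to_0 a b)" if "\<epsilon> > 0" for \<epsilon>
    by (rule tendsto_mesh_to_0_if_sequences[OF \<open>a < b\<close>]) (rule tendsto_in_probD(3)[OF lim that])
qed (rule L)

section \<open>The terms of the Fehlberg sums\<close>

text \<open>The mean value theorem produces a point between \<open>x u\<close> and \<open>x v\<close>, and by the intermediate value theorem
  the path visits it at some time in \<open>[u,v]\<close>. So the remainder is governed by the oscillation of \<open>\<Phi>' \<circ> x\<close> in time.\<close>

lemma C1_path_remainder:
  fixes x :: "real \<Rightarrow> real"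
  assumes x: "continuous_on {u..v} x" and deriv: "\<And>y. (\<Phi> has_real_derivative \<Phi>' y) (at y)"
    and uv: "u \<le> v" and small: "\<And>t. t \<in> {u..v} \<Longrightarrow> \<bar>\<Phi>' (x t) - \<Phi>' (x u)\<bar> \<le> \<theta>"
  shows "\<bar>\<Phi> (x v) - \<Phi> (x u) - \<Phi>' (x u) * (x v - x u)\<bar> \<le> \<theta> * \<bar>x v - x u\<bar>"
proof -
  have "\<exists>z. min (x u) (x v) \<le> z \<and> z \<le> max (x u) (x v) \<and> \<Phi> (x v) - \<Phi> (x u) = (x v - x u) * \<Phi>' z"
  proof (cases "x u" "x v" rule: linorder_cases)
    case less
    then obtain z where "x u < z" "z < x v" "\<Phi> (x v) - \<Phi> (x u) = (x v - x u) * \<Phi>' z"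
      using MVT2[OF less deriv] by blast
    then show ?thesis by (intro exI[of _ z]) auto
  next
    case equal
    then show ?thesis by auto
  next
    case greater
    then obtain z where "x v < z" "z < x u" "\<Phi> (x u) - \<Phi> (x v) = (x u - x v) * \<Phi>' z"
      using MVT2[OF greater deriv] by blast
    then show ?thesis by (intro exI[of _ z]) (auto simp: algebra_simps)
  qed
  then obtain z where z: "min (x u) (x v) \<le> z" "z \<le> max (x u) (x v)" "\<Phi> (x v) - \<Phi> (x u) = (x v - x u) * \<Phi>' z"
    by blast
  obtain t where t: "t \<in> {u..v}" "x t = z"
  proof (cases "x u \<le> x v")
    case True
    then show thesis using IVT'[of x u z v] x uv z that by auto
  next
    case False
    then show thesis using IVT2'[of x v z u] x uv z that by auto
  qed
  have "\<Phi> (x v) - \<Phi> (x u) - \<Phi>' (x u) * (x v - x u) = (\<Phi>' (x t) - \<Phi>' (x u)) * (x v - x u)"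
    unfolding z(3) t(2) by (simp add: algebra_simps)
  then show ?thesis using small[OF t(1)] by (simp add: abs_mult mult_right_mono)
qed

locale brownian_C1_integrand = brownian_motion M W
  for M :: "'a measure" and W :: "real \<Rightarrow> 'a \<Rightarrow> real" +
  fixes a b l :: real and \<Phi> \<Phi>' :: "real \<Rightarrow> real"
  assumes a_nonneg: "0 \<le> a" and a_less_b: "a < b" and l: "0 < l" "l < 1"
    and deriv: "\<And>x. (\<Phi> has_real_derivative \<Phi>' x) (at x)"
    and deriv_continuous: "continuous_on UNIV \<Phi>'"
begin

lemma Phi_continuous: "continuous_on UNIV \<Phi>"
  using deriv by (auto intro!: DERIV_isCont continuous_at_imp_continuous_on)

lemma Phi_measurable [measurable]: "\<Phi> \<in> borel_measurable borel" "\<Phi>' \<in> borel_measurable borel"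
  using Phi_continuous deriv_continuous by (auto intro: borel_measurable_continuous_onI)

lemma W_path_continuous: "AE \<omega> in M. continuous_on {a..b} (\<lambda>t. W t \<omega>)"
  using continuous_paths by eventually_elim (rule continuous_on_subset, use a_nonneg in auto)

lemma composed_path_continuous:
  assumes "continuous_on {a..b} (\<lambda>t. W t \<omega>)" and "continuous_on UNIV g"
  shows "continuous_on {a..b} (\<lambda>t. g (W t \<omega>) :: real)"
  by (rule continuous_on_compose2[OF assms(2,1)]) auto

sublocale integrand: adapted_continuous_process M W a b "\<lambda>t \<omega>. \<Phi> (W t \<omega>)"
proof
  show "(\<lambda>\<omega>. \<Phi> (W t \<omega>)) \<in> borel_measurable (\<F> t)" if "t \<in> {a..b}" for t
    using that a_nonneg by (intro measurable_compose[OF W_adapted Phi_measurable(1)]) auto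
  show "AE \<omega> in M. continuous_on {a..b} (\<lambda>t. \<Phi> (W t \<omega>))"
    using W_path_continuous by eventually_elim (rule composed_path_continuous[OF _ Phi_continuous])
qed (rule a_nonneg a_less_b)+

lemma lambda_sum_measurable:
  assumes "\<Delta> \<in> partitions a b"
  shows "lambda_sum l W (\<lambda>t \<omega>. \<Phi> (W t \<omega>)) \<Delta> \<in> borel_measurable M"
proof -
  obtain m t where \<Delta>: "\<Delta> = (m, t)" by (cases \<Delta>)
  note p = assms[unfolded \<Delta>]
  have t0: "0 \<le> t j" if "j \<le> m" for j using partition_bounds[OF p that] a_nonneg by simp
  have mid0: "0 \<le> l * t j + (1 - l) * t (j - 1)" if "j \<le> m" for j
    using t0[OF that] t0[of "j - 1"] that l by simp
  show ?thesis
    unfolding \<Delta> lambda_sum_def prod.case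
    by (intro borel_measurable_sum borel_measurable_times borel_measurable_diff
        measurable_compose[OF random_variable_W Phi_measurable(1)] random_variable_W mid0 t0) auto
qed

text \<open>As a function on the whole probability space the pathwise time integral need not be measurable for \<open>M\<close>, as a
  limit in probability has to be. The limit function of the Riemann sums is, and both agree on continuous paths.\<close>

lemma time_integral_version:
  obtains J where "J \<in> borel_measurable M" "AE \<omega> in M. J \<omega> = (LBINT t:{a..b}. \<Phi>' (W t \<omega>))"
proof -
  interpret D: partition_sequence a b Suc "\<lambda>k j. a + real j * ((b - a) / real (Suc k))"
    by (rule uniform_partition_sequence[OF a_less_b])
  define s where "s = (\<lambda>k j. a + real j * ((b - a) / real (Suc k)))"
  define R where "R k \<omega> = (\<Sum>j<Suc k. \<Phi>' (W (s k j) \<omega>) * (s k (Suc j) - s k j))" for k \<omega>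
  have "0 \<le> s k j" for k j unfolding s_def using a_nonneg a_less_b by simp
  then have R: "R k \<in> borel_measurable M" for k
    unfolding R_def
    by (intro borel_measurable_sum borel_measurable_times measurable_compose[OF random_variable_W Phi_measurable(2)]) auto
  have "AE \<omega> in M. lim (\<lambda>k. R k \<omega>) = (LBINT t:{a..b}. \<Phi>' (W t \<omega>))"
    using W_path_continuous
  proof eventually_elim
    case (elim \<omega>)
    show ?case unfolding R_def s_def
      by (rule limI[OF D.riemann_sum_tendsto[OF composed_path_continuous[OF elim deriv_continuous]]])
  qed
  moreover have "(\<lambda>\<omega>. lim (\<lambda>k. R k \<omega>)) \<in> borel_measurable M" using R by measurable
  ultimately show thesis by (rule that[rotated])
qed

end

locale brownian_C1_partition_sequence = brownian_C1_integrand M W a b l \<Phi> \<Phi>' + partition_sequence a b n s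
  for M :: "'a measure" and W :: "real \<Rightarrow> 'a \<Rightarrow> real" and a b l :: real and \<Phi> \<Phi>' :: "real \<Rightarrow> real"
    and n :: "nat \<Rightarrow> nat" and s :: "nat \<Rightarrow> nat \<Rightarrow> real"
begin

text \<open>The evaluation point of the Fehlberg sum in cell \<open>j\<close>, with \<open>l\<close> in the place of 255/512.\<close>

definition mid :: "nat \<Rightarrow> nat \<Rightarrow> real" where
  "mid k j = l * s k (Suc j) + (1 - l) * s k j"

lemma mid_minus: "mid k j - s k j = l * (s k (Suc j) - s k j)" "s k (Suc j) - mid k j = (1 - l) * (s k (Suc j) - s k j)"
  by (simp_all add: mid_def algebra_simps)

lemma points:
  assumes "j < n k"
  shows "0 \<le> s k j" "s k j < mid k j" "mid k j < s k (Suc j)" "s k (Suc j) \<le> b" "a \<le> s k j"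
proof -
  have "0 < s k (Suc j) - s k j" using partition_less[OF partition, of j "Suc j" k] assms by simp
  then have "0 < mid k j - s k j" "0 < s k (Suc j) - mid k j" using l by (simp_all only: mid_minus) auto
  then show "s k j < mid k j" "mid k j < s k (Suc j)" by auto
  show "a \<le> s k j" "s k (Suc j) \<le> b" using partition_bounds[OF partition[of k]] assms by auto
  then show "0 \<le> s k j" using a_nonneg by simp
qed

lemma point_order:
  assumes "i < j" "j < n k"
  shows "s k (Suc i) \<le> s k j"
  using partition_mono[OF partition, of "Suc i" j k] assms by simp

lemma sum_cells: "(\<Sum>j<n k. s k (Suc j) - s k j) = b - a"
  using partition[of k] by (simp add: sum_lessThan_telescope partitions_def)

lemma W_measurable: "j < n k \<Longrightarrow> W (s k j) \<in> borel_measurable M" "j < n k \<Longrightarrow> W (mid k j) \<in> borel_measurable M"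
  "j < n k \<Longrightarrow> W (s k (Suc j)) \<in> borel_measurable M"
  using points[of j k] by (auto intro!: random_variable_W)

text \<open>The tail bound with the filtration read at the intermediate points \<open>mid k j\<close>; the coefficients are small because
  \<open>\<Phi> \<circ> W\<close> has continuous paths.\<close>

lemma forward_part_tendsto_0:
  "tendsto_in_prob M (\<lambda>k \<omega>. \<Sum>j<n k. (\<Phi> (W (mid k j) \<omega>) - \<Phi> (W (s k j) \<omega>)) * (W (s k (Suc j)) \<omega> - W (mid k j) \<omega>))
     (\<lambda>_. 0) sequentially"
proof -
  define \<xi> where "\<xi> k j \<omega> = \<Phi> (W (mid k j) \<omega>) - \<Phi> (W (s k j) \<omega>)" for k j \<omega>
  define Q where "Q k \<omega> = (\<Sum>j<n k. (\<xi> k j \<omega>)\<^sup>2 * (s k (Suc j) - mid k j))" for k \<omega>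
  have \<xi>M: "\<xi> k j \<in> borel_measurable M" if "j < n k" for k j
    unfolding \<xi>_def by (intro borel_measurable_diff measurable_compose[OF _ Phi_measurable(1)] W_measurable that)
  have Q0: "0 \<le> Q k \<omega>" for k \<omega>
    unfolding Q_def by (intro sum_nonneg mult_nonneg_nonneg) (use points in \<open>auto intro: less_imp_le\<close>)
  have QM: "Q k \<in> borel_measurable M" for k
    unfolding Q_def by (intro borel_measurable_sum borel_measurable_times borel_measurable_power \<xi>M) auto
  have Q: "tendsto_in_prob M Q (\<lambda>_. 0) sequentially"
  proof (rule tendsto_in_prob_if_AE[OF QM])
    show "AE \<omega> in M. (\<lambda>k. Q k \<omega>) \<longlonglongrightarrow> 0"
      using W_path_continuous
    proof eventually_elim
      case (elim \<omega>)
      show ?case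
      proof (rule tendstoI)
        fix e :: real assume e: "e > 0"
        \<comment> \<open>chosen such that \<open>r\<^sup>2 (b - a) = e / 2\<close>\<close>
        define r where "r = sqrt (e / (2 * (b - a)))"
        have r: "r > 0" "r\<^sup>2 = e / (2 * (b - a))" using e a_less_b by (auto simp: r_def)
        from eventually_cell_modulus[OF composed_path_continuous[OF elim Phi_continuous] r(1)]
        show "\<forall>\<^sub>F k in sequentially. dist (Q k \<omega>) 0 < e"
        proof eventually_elim
          case (elim k)
          have "Q k \<omega> \<le> (\<Sum>j<n k. r\<^sup>2 * (s k (Suc j) - s k j))"
            unfolding Q_def
          proof (intro sum_mono mult_mono)
            fix j assume "j \<in> {..<n k}"
            then have j: "j < n k" by simp
            note pt = points[OF j]
            have "\<bar>\<xi> k j \<omega>\<bar> < r" unfolding \<xi>_def using elim j pt by auto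
            then show "(\<xi> k j \<omega>)\<^sup>2 \<le> r\<^sup>2" using abs_le_square_iff[of "\<xi> k j \<omega>" r] by simp
            show "s k (Suc j) - mid k j \<le> s k (Suc j) - s k j" "0 \<le> s k (Suc j) - mid k j" using pt by auto
          qed simp
          also have "\<dots> = r\<^sup>2 * (b - a)" by (simp only: sum_distrib_left[symmetric] sum_cells)
          also have "\<dots> = e / 2" using a_less_b unfolding r(2) by (simp add: field_simps)
          finally show ?case using Q0[of k \<omega>] e by (simp add: dist_real_def)
        qed
      qed
    qed
  qed simp
  have "tendsto_in_prob M (\<lambda>k \<omega>. \<Sum>j<n k. \<xi> k j \<omega> * (W (s k (Suc j)) \<omega> - W (mid k j) \<omega>)) (\<lambda>_. 0) sequentially"
  proof (rule tendsto_in_prob_0_if_bound[OF Q])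
    show "(\<lambda>\<omega>. \<Sum>j<n k. \<xi> k j \<omega> * (W (s k (Suc j)) \<omega> - W (mid k j) \<omega>)) \<in> borel_measurable M" for k
      by (intro borel_measurable_sum borel_measurable_times borel_measurable_diff \<xi>M W_measurable) auto
    fix k and \<epsilon> \<delta> :: real assume pos: "\<epsilon> > 0" "\<delta> > 0"
    show "prob {\<omega> \<in> space M. \<bar>\<Sum>j<n k. \<xi> k j \<omega> * (W (s k (Suc j)) \<omega> - W (mid k j) \<omega>)\<bar> > \<epsilon>}
      \<le> prob {\<omega> \<in> space M. \<bar>Q k \<omega>\<bar> > \<delta>} + \<delta> / \<epsilon>\<^sup>2"
      unfolding abs_of_nonneg[OF Q0] unfolding Q_def
    proof (rule martingale_transform_tail_bound[of "n k" "\<lambda>j. \<F> (mid k j)"])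
      fix j assume j: "j < n k"
      have lt: "0 \<le> mid k j" "mid k j < s k (Suc j)" using points[OF j] by auto
      show "sets (\<F> (mid k j)) \<subseteq> events \<and> space (\<F> (mid k j)) = space M" by (simp add: natural_filtration_basics(1,2))
      show "(\<lambda>\<omega>. W (s k (Suc j)) \<omega> - W (mid k j) \<omega>) \<in> borel_measurable M"
        by (intro borel_measurable_diff W_measurable j)
      show "indep_var borel Z borel (\<lambda>\<omega>. W (s k (Suc j)) \<omega> - W (mid k j) \<omega>)"
        if "Z \<in> borel_measurable (\<F> (mid k j))" for Z
        by (rule increment_indep[OF lt that])
      show "integrable M (\<lambda>\<omega>. (W (s k (Suc j)) \<omega> - W (mid k j) \<omega>)\<^sup>2)" by (rule increment_moments(1)[OF lt])
      show "expectation (\<lambda>\<omega>. W (s k (Suc j)) \<omega> - W (mid k j) \<omega>) = 0" by (rule increment_moments(2)[OF lt])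
      show "expectation (\<lambda>\<omega>. (W (s k (Suc j)) \<omega> - W (mid k j) \<omega>)\<^sup>2) = s k (Suc j) - mid k j"
        by (rule increment_moments(3)[OF lt])
      show "0 < s k (Suc j) - mid k j" using lt by simp
      fix i
      show "\<xi> k i \<in> borel_measurable (\<F> (mid k j))" if "i \<le> j"
      proof -
        have "mid k i \<le> mid k j"
          using points[of i k] points[OF j] point_order[of i j k] j that by (cases "i = j") auto
        then show ?thesis unfolding \<xi>_def
          using points[of i k] j that
          by (intro borel_measurable_diff measurable_compose[OF _ Phi_measurable(1)] W_adapted) auto
      qed
      show "(\<lambda>\<omega>. W (s k (Suc i)) \<omega> - W (mid k i) \<omega>) \<in> borel_measurable (\<F> (mid k j))" if "i < j"
        using points[of i k] points[OF j] point_order[OF that j] j that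
        by (intro borel_measurable_diff W_adapted) auto
    qed (use pos in auto)
  qed
  then show ?thesis by (simp only: \<xi>_def)
qed

text \<open>The tail bound with the filtration read at the partition points. On each path the coefficients are bounded, and
  the variances sum up to at most a constant times the mesh.\<close>

lemma quadratic_fluctuation_tendsto_0:
  "tendsto_in_prob M (\<lambda>k \<omega>. \<Sum>j<n k. \<Phi>' (W (s k j) \<omega>) * ((W (mid k j) \<omega> - W (s k j) \<omega>)\<^sup>2 - (mid k j - s k j)))
     (\<lambda>_. 0) sequentially"
proof -
  define Q where "Q k \<omega> = (\<Sum>j<n k. (\<Phi>' (W (s k j) \<omega>))\<^sup>2 * (2 * (mid k j - s k j)\<^sup>2))" for k \<omega>
  have \<xi>M: "(\<lambda>\<omega>. \<Phi>' (W (s k j) \<omega>)) \<in> borel_measurable M" if "j < n k" for k j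
    by (intro measurable_compose[OF _ Phi_measurable(2)] W_measurable that)
  have Q0: "0 \<le> Q k \<omega>" for k \<omega> unfolding Q_def by (intro sum_nonneg mult_nonneg_nonneg) auto
  have QM: "Q k \<in> borel_measurable M" for k
    unfolding Q_def by (intro borel_measurable_sum borel_measurable_times borel_measurable_power \<xi>M) auto
  have Q: "tendsto_in_prob M Q (\<lambda>_. 0) sequentially"
  proof (rule tendsto_in_prob_if_AE[OF QM])
    show "AE \<omega> in M. (\<lambda>k. Q k \<omega>) \<longlonglongrightarrow> 0"
      using W_path_continuous
    proof eventually_elim
      case (elim \<omega>)
      obtain C where C: "C \<ge> 0" "\<And>t. t \<in> {a..b} \<Longrightarrow> \<bar>\<Phi>' (W t \<omega>)\<bar> \<le> C"
        using continuous_bound[OF composed_path_continuous[OF elim deriv_continuous]] by blast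
      have le: "Q k \<omega> \<le> C\<^sup>2 * 2 * (b - a) * mesh (n k, s k)" for k
      proof -
        have "Q k \<omega> \<le> (\<Sum>j<n k. C\<^sup>2 * (2 * (mesh (n k, s k) * (s k (Suc j) - s k j))))"
          unfolding Q_def
        proof (intro sum_mono mult_mono)
          fix j assume "j \<in> {..<n k}"
          then have j: "j < n k" by simp
          note pt = points[OF j]
          have "\<bar>\<Phi>' (W (s k j) \<omega>)\<bar> \<le> C" using C pt by auto
          then show "(\<Phi>' (W (s k j) \<omega>))\<^sup>2 \<le> C\<^sup>2" using abs_le_square_iff[of "\<Phi>' (W (s k j) \<omega>)" C] C(1) by simp
          have "(mid k j - s k j) * (mid k j - s k j) \<le> mesh (n k, s k) * (s k (Suc j) - s k j)"
            using mesh_ge[OF j, of "s k"] pt by (intro mult_mono) auto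
          then show "(mid k j - s k j)\<^sup>2 \<le> mesh (n k, s k) * (s k (Suc j) - s k j)" by (simp add: power2_eq_square)
        qed auto
        also have "\<dots> = C\<^sup>2 * (2 * (mesh (n k, s k) * (b - a)))" by (simp only: sum_distrib_left[symmetric] sum_cells)
        finally show ?thesis by (simp add: mult_ac)
      qed
      have "(\<lambda>k. C\<^sup>2 * 2 * (b - a) * mesh (n k, s k)) \<longlonglongrightarrow> C\<^sup>2 * 2 * (b - a) * 0"
        by (intro tendsto_intros mesh_lim)
      then have lim0: "(\<lambda>k. C\<^sup>2 * 2 * (b - a) * mesh (n k, s k)) \<longlonglongrightarrow> 0" by simp
      show ?case
        by (rule tendsto_sandwich[OF _ _ tendsto_const lim0]) (auto intro!: always_eventually Q0 le)
    qed
  qed simp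
  show ?thesis
  proof (rule tendsto_in_prob_0_if_bound[OF Q])
    show "(\<lambda>\<omega>. \<Sum>j<n k. \<Phi>' (W (s k j) \<omega>) * ((W (mid k j) \<omega> - W (s k j) \<omega>)\<^sup>2 - (mid k j - s k j))) \<in> borel_measurable M" for k
      by (intro borel_measurable_sum borel_measurable_times borel_measurable_diff borel_measurable_power \<xi>M W_measurable) auto
    fix k and \<epsilon> \<delta> :: real assume pos: "\<epsilon> > 0" "\<delta> > 0"
    show "prob {\<omega> \<in> space M. \<bar>\<Sum>j<n k. \<Phi>' (W (s k j) \<omega>) * ((W (mid k j) \<omega> - W (s k j) \<omega>)\<^sup>2 - (mid k j - s k j))\<bar> > \<epsilon>}
      \<le> prob {\<omega> \<in> space M. \<bar>Q k \<omega>\<bar> > \<delta>} + \<delta> / \<epsilon>\<^sup>2"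
      unfolding abs_of_nonneg[OF Q0] unfolding Q_def
    proof (rule martingale_transform_tail_bound[of "n k" "\<lambda>j. \<F> (s k j)"])
      fix j assume j: "j < n k"
      have lt: "0 \<le> s k j" "s k j < mid k j" using points[OF j] by auto
      let ?c = "\<lambda>x. x\<^sup>2 - (mid k j - s k j)"
      show "sets (\<F> (s k j)) \<subseteq> events \<and> space (\<F> (s k j)) = space M" by (simp add: natural_filtration_basics(1,2))
      show "(\<lambda>\<omega>. (W (mid k j) \<omega> - W (s k j) \<omega>)\<^sup>2 - (mid k j - s k j)) \<in> borel_measurable M"
        by (intro borel_measurable_diff borel_measurable_power W_measurable j) auto
      show "indep_var borel Z borel (\<lambda>\<omega>. (W (mid k j) \<omega> - W (s k j) \<omega>)\<^sup>2 - (mid k j - s k j))"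
        if "Z \<in> borel_measurable (\<F> (s k j))" for Z
        using indep_var_compose[OF increment_indep[OF lt that], of "\<lambda>x. x" borel ?c borel] by (simp add: comp_def)
      show "integrable M (\<lambda>\<omega>. ((W (mid k j) \<omega> - W (s k j) \<omega>)\<^sup>2 - (mid k j - s k j))\<^sup>2)"
        "expectation (\<lambda>\<omega>. (W (mid k j) \<omega> - W (s k j) \<omega>)\<^sup>2 - (mid k j - s k j)) = 0"
        "expectation (\<lambda>\<omega>. ((W (mid k j) \<omega> - W (s k j) \<omega>)\<^sup>2 - (mid k j - s k j))\<^sup>2) = 2 * (mid k j - s k j)\<^sup>2"
        by (fact centred_square_moments[OF lt])+
      show "0 < 2 * (mid k j - s k j)\<^sup>2" using lt by simp
      fix i
      show "(\<lambda>\<omega>. \<Phi>' (W (s k i) \<omega>)) \<in> borel_measurable (\<F> (s k j))" if "i \<le> j"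
        using points[of i k] partition_mono[OF partition, of i j k] j that
        by (intro measurable_compose[OF _ Phi_measurable(2)] W_adapted) auto
      show "(\<lambda>\<omega>. (W (mid k i) \<omega> - W (s k i) \<omega>)\<^sup>2 - (mid k i - s k i)) \<in> borel_measurable (\<F> (s k j))" if "i < j"
        using points[of i k] point_order[OF that j] j that
        by (intro borel_measurable_diff borel_measurable_power W_adapted) auto
    qed (use pos in auto)
  qed
qed

text \<open>With high probability every remainder is at most \<open>\<theta>\<close> times the absolute increment. Then the sum is at most \<open>\<theta>\<close> times
  the sum of the squared increments, whose expectation is at most \<open>b - a\<close>.\<close>

lemma taylor_remainder_tendsto_0:
  "tendsto_in_prob M (\<lambda>k \<omega>. \<Sum>j<n k. (\<Phi> (W (mid k j) \<omega>) - \<Phi> (W (s k j) \<omega>) - \<Phi>' (W (s k j) \<omega>) * (W (mid k j) \<omega> - W (s k j) \<omega>))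
     * (W (mid k j) \<omega> - W (s k j) \<omega>)) (\<lambda>_. 0) sequentially"
proof -
  define d where "d k j \<omega> = W (mid k j) \<omega> - W (s k j) \<omega>" for k j \<omega>
  define r where "r k j \<omega> = \<Phi> (W (mid k j) \<omega>) - \<Phi> (W (s k j) \<omega>) - \<Phi>' (W (s k j) \<omega>) * d k j \<omega>" for k j \<omega>
  define S where "S k \<omega> = (\<Sum>j<n k. (d k j \<omega>)\<^sup>2)" for k \<omega>
  have dM: "d k j \<in> borel_measurable M" if "j < n k" for k j
    unfolding d_def by (intro borel_measurable_diff W_measurable that)
  have rM: "r k j \<in> borel_measurable M" if "j < n k" for k j
    unfolding r_def by (intro borel_measurable_diff borel_measurable_times measurable_compose[OF _ Phi_measurable(1)]
        measurable_compose[OF _ Phi_measurable(2)] W_measurable dM that)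
  have S0: "0 \<le> S k \<omega>" for k \<omega> unfolding S_def by (simp add: sum_nonneg)
  have SM[measurable]: "S k \<in> borel_measurable M" for k
    unfolding S_def by (intro borel_measurable_sum borel_measurable_power dM) auto
  have S: "integrable M (S k)" "expectation (S k) \<le> b - a" for k
  proof -
    have m: "integrable M (\<lambda>\<omega>. (d k j \<omega>)\<^sup>2)" "expectation (\<lambda>\<omega>. (d k j \<omega>)\<^sup>2) = mid k j - s k j" if "j < n k" for j
      unfolding d_def using increment_moments(1,3)[of "s k j" "mid k j"] points[OF that] by auto
    then show "integrable M (S k)" unfolding S_def by (intro Bochner_Integration.integrable_sum) auto
    have "expectation (S k) = (\<Sum>j<n k. mid k j - s k j)"
      unfolding S_def using m by (subst Bochner_Integration.integral_sum) auto
    also have "\<dots> \<le> (\<Sum>j<n k. s k (Suc j) - s k j)" by (intro sum_mono) (use points in \<open>auto intro: less_imp_le\<close>)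
    finally show "expectation (S k) \<le> b - a" by (simp only: sum_cells)
  qed
  define Y where "Y k \<omega> = (\<Sum>j<n k. r k j \<omega> * d k j \<omega>)" for k \<omega>
  have YM[measurable]: "Y k \<in> borel_measurable M" for k
    unfolding Y_def by (intro borel_measurable_sum borel_measurable_times rM dM) auto
  define B where "B \<theta> k = {\<omega> \<in> space M. \<exists>j\<in>{..<n k}. \<bar>r k j \<omega>\<bar> > \<theta> * \<bar>d k j \<omega>\<bar>}" for \<theta> k
  have BM: "B \<theta> k \<in> events" for \<theta> k
    unfolding B_def
  proof (rule sets.sets_Collect_finite_Ex)
    fix j assume "j \<in> {..<n k}"
    then have [measurable]: "r k j \<in> borel_measurable M" "d k j \<in> borel_measurable M" using rM dM by auto
    show "{\<omega> \<in> space M. \<bar>r k j \<omega>\<bar> > \<theta> * \<bar>d k j \<omega>\<bar>} \<in> events" by measurable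
  qed simp
  have B: "(\<lambda>k. prob (B \<theta> k)) \<longlonglongrightarrow> 0" if \<theta>: "\<theta> > 0" for \<theta>
  proof (rule prob_tendsto_0_if_AE_eventually[OF BM])
    show "AE \<omega> in M. \<forall>\<^sub>F k in sequentially. \<omega> \<notin> B \<theta> k"
      using W_path_continuous
    proof eventually_elim
      case (elim \<omega>)
      from eventually_cell_modulus[OF composed_path_continuous[OF elim deriv_continuous] \<theta>]
      show ?case
      proof eventually_elim
        case cell: (elim k)
        have "\<bar>r k j \<omega>\<bar> \<le> \<theta> * \<bar>d k j \<omega>\<bar>" if j: "j < n k" for j
          unfolding r_def d_def
        proof (rule C1_path_remainder[where x = "\<lambda>t. W t \<omega>", OF _ deriv])
          note pt = points[OF j]
          show "continuous_on {s k j..mid k j} (\<lambda>t. W t \<omega>)"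
            by (rule continuous_on_subset[OF elim]) (use pt in auto)
          show "s k j \<le> mid k j" using pt by simp
          show "\<bar>\<Phi>' (W t \<omega>) - \<Phi>' (W (s k j) \<omega>)\<bar> \<le> \<theta>" if "t \<in> {s k j..mid k j}" for t
            using cell j pt that by (intro less_imp_le) auto
        qed
        then show ?case by (auto simp: B_def not_less)
      qed
    qed
  qed
  have bound: "prob {\<omega> \<in> space M. \<bar>Y k \<omega>\<bar> > \<epsilon>} \<le> prob (B \<theta> k) + \<theta> * (b - a) / \<epsilon>" if pos: "\<theta> > 0" "\<epsilon> > 0" for \<theta> \<epsilon> k
  proof -
    have "\<omega> \<in> B \<theta> k \<or> \<epsilon> / \<theta> \<le> S k \<omega>" if w: "\<omega> \<in> space M" "\<bar>Y k \<omega>\<bar> > \<epsilon>" for \<omega>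
    proof (rule disjCI)
      assume "\<not> \<epsilon> / \<theta> \<le> S k \<omega>"
      then have S_lt: "\<theta> * S k \<omega> < \<epsilon>" using pos by (simp add: field_simps)
      show "\<omega> \<in> B \<theta> k"
      proof (rule ccontr)
        assume "\<omega> \<notin> B \<theta> k"
        then have le: "\<bar>r k j \<omega>\<bar> \<le> \<theta> * \<bar>d k j \<omega>\<bar>" if "j < n k" for j using w that by (force simp: B_def)
        have "\<bar>Y k \<omega>\<bar> \<le> (\<Sum>j<n k. \<bar>r k j \<omega> * d k j \<omega>\<bar>)" unfolding Y_def by (rule sum_abs)
        also have "\<dots> \<le> (\<Sum>j<n k. \<theta> * (d k j \<omega>)\<^sup>2)"
        proof (rule sum_mono)
          fix j assume "j \<in> {..<n k}"
          then have "\<bar>r k j \<omega>\<bar> * \<bar>d k j \<omega>\<bar> \<le> (\<theta> * \<bar>d k j \<omega>\<bar>) * \<bar>d k j \<omega>\<bar>" using le by (intro mult_right_mono) auto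
          also have "\<dots> = \<theta> * (d k j \<omega>)\<^sup>2" by (simp add: power2_eq_square mult.assoc)
          finally show "\<bar>r k j \<omega> * d k j \<omega>\<bar> \<le> \<theta> * (d k j \<omega>)\<^sup>2" by (simp only: abs_mult)
        qed
        also have "\<dots> = \<theta> * S k \<omega>" by (simp only: S_def sum_distrib_left)
        finally show False using S_lt w by simp
      qed
    qed
    then have "prob {\<omega> \<in> space M. \<bar>Y k \<omega>\<bar> > \<epsilon>} \<le> prob (B \<theta> k \<union> {\<omega> \<in> space M. S k \<omega> \<ge> \<epsilon> / \<theta>})"
    proof (intro finite_measure_mono sets.Un BM)
      show "{\<omega> \<in> space M. S k \<omega> \<ge> \<epsilon> / \<theta>} \<in> events" by measurable
    qed blast
    also have "\<dots> \<le> prob (B \<theta> k) + prob {\<omega> \<in> space M. S k \<omega> \<ge> \<epsilon> / \<theta>}"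
      by (intro measure_Un_le BM) measurable
    also have "prob {\<omega> \<in> space M. S k \<omega> \<ge> \<epsilon> / \<theta>} \<le> expectation (S k) / (\<epsilon> / \<theta>)"
      by (rule integral_Markov_inequality_measure[where A = "{}"]) (use S(1) S0 pos in auto)
    also have "\<dots> \<le> (b - a) / (\<epsilon> / \<theta>)" using S(2) pos by (intro divide_right_mono) auto
    also have "\<dots> = \<theta> * (b - a) / \<epsilon>" by simp
    finally show ?thesis by simp
  qed
  have "tendsto_in_prob M Y (\<lambda>_. 0) sequentially"
  proof (rule tendsto_in_probI[OF YM])
    fix \<epsilon> :: real assume e: "\<epsilon> > 0"
    have "(\<lambda>k. prob {\<omega> \<in> space M. \<bar>Y k \<omega>\<bar> > \<epsilon>}) \<longlonglongrightarrow> 0"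
    proof (rule LIMSEQ_I)
      fix \<eta> :: real assume \<eta>: "\<eta> > 0"
      define \<theta> where "\<theta> = \<eta> * \<epsilon> / (2 * (b - a))"
      have "\<eta> * \<epsilon> / (2 * c) * c / \<epsilon> = \<eta> / 2" if "c > 0" for c using that e by simp
      then have \<theta>: "\<theta> > 0" "\<theta> * (b - a) / \<epsilon> = \<eta> / 2"
        using \<eta> e a_less_b by (simp_all only: \<theta>_def diff_gt_0_iff_gt) simp
      obtain N where N: "\<And>k. k \<ge> N \<Longrightarrow> norm (prob (B \<theta> k) - 0) < \<eta> / 2"
        using LIMSEQ_D[OF B[OF \<theta>(1)], of "\<eta> / 2"] \<eta> by auto
      have "norm (prob {\<omega> \<in> space M. \<bar>Y k \<omega>\<bar> > \<epsilon>} - 0) < \<eta>" if "k \<ge> N" for k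
      proof -
        have "prob (B \<theta> k) < \<eta> / 2" using N[OF that] by simp
        then have "prob {\<omega> \<in> space M. \<bar>Y k \<omega>\<bar> > \<epsilon>} < \<eta>" using bound[OF \<theta>(1) e, of k] \<theta>(2) by linarith
        then show ?thesis by (simp only: diff_0_right real_norm_def abs_of_nonneg measure_nonneg)
      qed
      then show "\<exists>N. \<forall>k\<ge>N. norm (prob {\<omega> \<in> space M. \<bar>Y k \<omega>\<bar> > \<epsilon>} - 0) < \<eta>" by blast
    qed
    then show "(\<lambda>k. prob {\<omega> \<in> space M. \<bar>Y k \<omega> - 0\<bar> > \<epsilon>}) \<longlonglongrightarrow> 0" by simp
  qed simp
  then show ?thesis unfolding Y_def[abs_def] r_def d_def .
qed

text \<open>The coefficient \<open>l\<close> of the last sum appears because \<open>mid k j\<close> divides each cell in the ratio \<open>l : 1 - l\<close>.\<close>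

lemma lambda_sum_eq:
  "lambda_sum l W (\<lambda>t \<omega>. \<Phi> (W t \<omega>)) (n k, s k) \<omega> =
    (\<Sum>j<n k. \<Phi> (W (s k j) \<omega>) * (W (s k (Suc j)) \<omega> - W (s k j) \<omega>))
    + (\<Sum>j<n k. (\<Phi> (W (mid k j) \<omega>) - \<Phi> (W (s k j) \<omega>)) * (W (s k (Suc j)) \<omega> - W (mid k j) \<omega>))
    + (\<Sum>j<n k. \<Phi>' (W (s k j) \<omega>) * ((W (mid k j) \<omega> - W (s k j) \<omega>)\<^sup>2 - (mid k j - s k j)))
    + (\<Sum>j<n k. (\<Phi> (W (mid k j) \<omega>) - \<Phi> (W (s k j) \<omega>) - \<Phi>' (W (s k j) \<omega>) * (W (mid k j) \<omega> - W (s k j) \<omega>))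
        * (W (mid k j) \<omega> - W (s k j) \<omega>))
    + l * (\<Sum>j<n k. \<Phi>' (W (s k j) \<omega>) * (s k (Suc j) - s k j))"
proof -
  have "lambda_sum l W (\<lambda>t \<omega>. \<Phi> (W t \<omega>)) (n k, s k) \<omega>
    = (\<Sum>j<n k. \<Phi> (W (mid k j) \<omega>) * (W (s k (Suc j)) \<omega> - W (s k j) \<omega>))"
    unfolding lambda_sum_def prod.case One_nat_def sum.atLeast1_atMost_eq by (simp add: mid_def)
  also have "\<dots> = (\<Sum>j<n k. \<Phi> (W (s k j) \<omega>) * (W (s k (Suc j)) \<omega> - W (s k j) \<omega>)
    + (\<Phi> (W (mid k j) \<omega>) - \<Phi> (W (s k j) \<omega>)) * (W (s k (Suc j)) \<omega> - W (mid k j) \<omega>)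
    + \<Phi>' (W (s k j) \<omega>) * ((W (mid k j) \<omega> - W (s k j) \<omega>)\<^sup>2 - (mid k j - s k j))
    + (\<Phi> (W (mid k j) \<omega>) - \<Phi> (W (s k j) \<omega>) - \<Phi>' (W (s k j) \<omega>) * (W (mid k j) \<omega> - W (s k j) \<omega>))
        * (W (mid k j) \<omega> - W (s k j) \<omega>)
    + l * (\<Phi>' (W (s k j) \<omega>) * (s k (Suc j) - s k j)))"
  proof (rule sum.cong[OF refl])
    fix j
    have id: "pw * (v - u) = pu * (v - u) + (pw - pu) * (v - w) + q * ((w - u)\<^sup>2 - l * x)
      + (pw - pu - q * (w - u)) * (w - u) + l * (q * x)" for pw pu q u v w x :: real
      by (simp add: power2_eq_square algebra_simps)
    show "\<Phi> (W (mid k j) \<omega>) * (W (s k (Suc j)) \<omega> - W (s k j) \<omega>) =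
      \<Phi> (W (s k j) \<omega>) * (W (s k (Suc j)) \<omega> - W (s k j) \<omega>)
    + (\<Phi> (W (mid k j) \<omega>) - \<Phi> (W (s k j) \<omega>)) * (W (s k (Suc j)) \<omega> - W (mid k j) \<omega>)
    + \<Phi>' (W (s k j) \<omega>) * ((W (mid k j) \<omega> - W (s k j) \<omega>)\<^sup>2 - (mid k j - s k j))
    + (\<Phi> (W (mid k j) \<omega>) - \<Phi> (W (s k j) \<omega>) - \<Phi>' (W (s k j) \<omega>) * (W (mid k j) \<omega> - W (s k j) \<omega>))
        * (W (mid k j) \<omega> - W (s k j) \<omega>)
    + l * (\<Phi>' (W (s k j) \<omega>) * (s k (Suc j) - s k j))"
      unfolding mid_minus(1) by (rule id)
  qed
  finally show ?thesis by (simp only: sum.distrib sum_distrib_left)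
qed

lemma lambda_sum_tendsto:
  assumes I: "has_ito_integral M W a b (\<lambda>t \<omega>. \<Phi> (W t \<omega>)) I"
    and J: "J \<in> borel_measurable M" "AE \<omega> in M. J \<omega> = (LBINT t:{a..b}. \<Phi>' (W t \<omega>))"
  shows "tendsto_in_prob M (\<lambda>k. lambda_sum l W (\<lambda>t \<omega>. \<Phi> (W t \<omega>)) (n k, s k)) (\<lambda>\<omega>. I \<omega> + l * J \<omega>) sequentially"
proof -
  have "tendsto_in_prob M (\<lambda>k \<omega>. \<Sum>j<n k. \<Phi>' (W (s k j) \<omega>) * (s k (Suc j) - s k j)) J sequentially"
  proof (rule tendsto_in_prob_if_AE[OF _ J(1)])
    show "(\<lambda>\<omega>. \<Sum>j<n k. \<Phi>' (W (s k j) \<omega>) * (s k (Suc j) - s k j)) \<in> borel_measurable M" for k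
      by (intro borel_measurable_sum borel_measurable_times measurable_compose[OF _ Phi_measurable(2)] W_measurable) auto
    show "AE \<omega> in M. (\<lambda>k. \<Sum>j<n k. \<Phi>' (W (s k j) \<omega>) * (s k (Suc j) - s k j)) \<longlonglongrightarrow> J \<omega>"
      using W_path_continuous J(2)
    proof eventually_elim
      case (elim \<omega>)
      show ?case unfolding elim(2)
        by (rule riemann_sum_tendsto[OF composed_path_continuous[OF elim(1) deriv_continuous]])
    qed
  qed
  note riemann = tendsto_in_prob_cmult[OF this, of l]
  note left = integrand.left_sums_tendsto_ito_integral[OF I partition_sequence_axioms]
  from tendsto_in_prob_add[OF tendsto_in_prob_add[OF tendsto_in_prob_add[OF tendsto_in_prob_add[OF left
    forward_part_tendsto_0] quadratic_fluctuation_tendsto_0] taylor_remainder_tendsto_0] riemann]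
  show ?thesis unfolding lambda_sum_eq[abs_def] by simp
qed

end

lemma (in brownian_C1_integrand) lambda_sum_tendsto_mesh_to_0:
  assumes I: "has_ito_integral M W a b (\<lambda>t \<omega>. \<Phi> (W t \<omega>)) I"
    and J: "J \<in> borel_measurable M" "AE \<omega> in M. J \<omega> = (LBINT t:{a..b}. \<Phi>' (W t \<omega>))"
  shows "tendsto_in_prob M (lambda_sum l W (\<lambda>t \<omega>. \<Phi> (W t \<omega>))) (\<lambda>\<omega>. I \<omega> + l * J \<omega>) (mesh_to_0 a b)"
proof (rule tendsto_in_prob_mesh_to_0_if_sequences[OF a_less_b lambda_sum_measurable])
  have "I \<in> borel_measurable M" using I by (auto simp: has_ito_integral_def tendsto_in_prob_def)
  then show "(\<lambda>\<omega>. I \<omega> + l * J \<omega>) \<in> borel_measurable M" using J(1) by measurable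
  fix n s assume "partition_sequence a b n s"
  then interpret brownian_C1_partition_sequence M W a b l \<Phi> \<Phi>' n s
    by (simp add: brownian_C1_partition_sequence_def brownian_C1_integrand_axioms)
  show "tendsto_in_prob M (\<lambda>k. lambda_sum l W (\<lambda>t \<omega>. \<Phi> (W t \<omega>)) (n k, s k)) (\<lambda>\<omega>. I \<omega> + l * J \<omega>) sequentially"
    by (rule lambda_sum_tendsto[OF I J])
qed

theorem theorem6p2:
  fixes M :: "'a measure" and W :: "real \<Rightarrow> 'a \<Rightarrow> real"
    and a b :: real and \<Phi> \<Phi>' :: "real \<Rightarrow> real"
  assumes "brownian_motion M W"
    and "0 \<le> a" and "a < b"
    and "\<And>x. (\<Phi> has_real_derivative \<Phi>' x) (at x)"
    and "continuous_on UNIV \<Phi>'"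
  shows "(\<exists>L. has_fehlberg_integral M W a b (\<lambda>t \<omega>. \<Phi> (W t \<omega>)) L) \<and>
    (\<exists>I. has_ito_integral M W a b (\<lambda>t \<omega>. \<Phi> (W t \<omega>)) I) \<and>
    (AE \<omega> in M. fehlberg_integral M W a b (\<lambda>t \<omega>. \<Phi> (W t \<omega>)) \<omega> =
       ito_integral M W a b (\<lambda>t \<omega>. \<Phi> (W t \<omega>)) \<omega> +
       255 / 512 * (LBINT t:{a..b}. \<Phi>' (W t \<omega>)))"
proof -
  interpret brownian_motion M W by fact
  interpret brownian_C1_integrand M W a b "255 / 512" \<Phi> \<Phi>'
    by unfold_locales (use assms in auto)
  let ?X = "\<lambda>t \<omega>. \<Phi> (W t \<omega>)"
  note ex_I = integrand.ito_integral_exists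
  then have I: "has_ito_integral M W a b ?X (ito_integral M W a b ?X)"
    unfolding ito_integral_def by (rule someI_ex)
  obtain J where J: "J \<in> borel_measurable M" "AE \<omega> in M. J \<omega> = (LBINT t:{a..b}. \<Phi>' (W t \<omega>))"
    by (rule time_integral_version)
  have lim: "has_fehlberg_integral M W a b ?X (\<lambda>\<omega>. ito_integral M W a b ?X \<omega> + 255 / 512 * J \<omega>)"
    unfolding has_fehlberg_integral_def by (rule lambda_sum_tendsto_mesh_to_0[OF I J])
  then have ex_L: "\<exists>L. has_fehlberg_integral M W a b ?X L" by blast
  then have "has_fehlberg_integral M W a b ?X (fehlberg_integral M W a b ?X)"
    unfolding fehlberg_integral_def by (rule someI_ex)
  then have "AE \<omega> in M. fehlberg_integral M W a b ?X \<omega> = ito_integral M W a b ?X \<omega> + 255 / 512 * J \<omega>"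
    using lim unfolding has_fehlberg_integral_def
    by (rule tendsto_in_prob_unique[OF mesh_to_0_nontrivial[OF a_less_b]])
  then have "AE \<omega> in M. fehlberg_integral M W a b ?X \<omega> =
      ito_integral M W a b ?X \<omega> + 255 / 512 * (LBINT t:{a..b}. \<Phi>' (W t \<omega>))"
    using J(2) by eventually_elim simp
  then show ?thesis using ex_I ex_L by blast
qed

end
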